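(* Let $\mathcal P$ be the plant described in the context (with $A,B_1,B_2,C_2,D_{21}$ block-diagonal), let $\tau\ge 0$, and suppose the system assumptions hold. Let $F_d$ and $L_d$ be block-diagonal matrices (partitioned conformally with the $N$ agents, with diagonal blocks of sizes $m_i\times n_i$ and $n_i\times p_i$ respectively) such that $A+B_2F_d$ and $A+L_dC_2$ are Hurwitz. Then the following are equivalent: (i) $\mathcal K\in\mathcal S_\tau$ and $\mathcal K$ stabilizes $\mathcal P$. (ii) $\mathcal K=\mathcal F_l(\mathcal J,\mathcal Q)$ for some $\mathcal Q\in\mathcal H_\infty\cap\mathcal S_\tau$, where $$\mathcal J=\left[\begin{array}{c|cc}A+B_2F_d+L_dC_2&-L_d&B_2\\ \hline F_d&0&I\\ -C_2&I&0\end{array}\right].$$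
   Context: Plant. There are $N$ agents, $[N]=\{1,\dots,N\}$. Agent $i$ has state, input and measurement dimensions $n_i,m_i,p_i$; $n=\sum n_i$, $m=\sum m_i$, $p=\sum p_i$. The aggregate dynamics are $\dot x=Ax+B_1w+B_2u$, $z=C_1x+D_{12}u$, $y=C_2x+D_{21}w$, where $x,w,u,y$ are partitioned into $N$ pieces and $A,B_1,B_2,C_2,D_{21}$ are block-diagonal with respect to this partition ($C_1,D_{12}$ may be dense). The transfer matrix $(w,u)\mapsto(z,y)$ is $$\mathcal P=\begin{bmatrix}\mathcal P_{11}&\mathcal P_{12}\\ \mathcal P_{21}&\mathcal P_{22}\end{bmatrix}=\left[\begin{array}{c|cc}A&B_1&B_2\\ \hline C_1&0&D_{12}\\ C_2&D_{21}&0\end{array}\right],\qquad \left[\begin{array}{c|c}A&B\\ \hline C&D\end{array}\right]:=D+C(sI-A)^{-1}B.$$ Information structure. A directed graph on $[N]$ is given; write $j\to i$ if $i\ne j$ and there is a directed path from $j$ to $i$. $\mathcal L_{\mathrm{prop}}$ is the set of proper transfer matrices, i.e. those $\mathcal G$ with $\sup_{\mathrm{Re}(s)>\alpha}\|\mathcal G(s)\|<\infty$ for some $\alpha>0$. For $\tau\ge0$, $\mathcal S_\tau$ is the set of block transfer matrices (blocks indexed by $i,j\in[N]$, block $(i,j)$ of size $m_i\times p_j$) whose $(i,i)$ block is $\mathcal K_{ii}$, whose $(i,j)$ block is $e^{-s\tau}\mathcal K_{ij}$ if $j\to i$, and whose $(i,j)$ block is $0$ otherwise, where all $\mathcal K_{ij}\in\mathcal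 L_{\mathrm{prop}}$. Stabilization. $u=\mathcal Ky$ stabilizes $\mathcal P$ if $\begin{bmatrix}I&-\mathcal P_{22}\\-\mathcal K&I\end{bmatrix}^{-1}\in\mathcal H_\infty$ ($\mathcal H_\infty$: matrix functions analytic and bounded in the open right half plane). The lower linear fractional transformation is $\mathcal F_l(\mathcal J,\mathcal Q)=\mathcal J_{11}+\mathcal J_{12}\mathcal Q(I-\mathcal J_{22}\mathcal Q)^{-1}\mathcal J_{21}$. A matrix is Hurwitz if all its eigenvalues have negative real part. System assumptions. Matrices $(A,B,C,D)$ satisfy the Riccati assumptions if (R1) $D^{\mathsf T}D\succ0$; (R2) $(A,B)$ is stabilizable; (R3) $\begin{bmatrix}A-j\omega I&B\\C&D\end{bmatrix}$ has full column rank for all $\omega\in\mathbb R$. The system assumptions are: the Riccati assumptions hold for $(A,B_2,C_1,D_{12})$ and for $(A_{ii}^{\mathsf T},C_{2_{ii}}^{\mathsf T},B_{1_{ii}}^{\mathsf T},D_{21_{ii}}^{\mathsf T})$ for every $i\in[N]$, where the subscript $ii$ denotes the $i$-th diagonal block. *)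

theory Defs
  imports
    "HOL-Complex_Analysis.Complex_Analysis"
    "Jordan_Normal_Form.DL_Rank"
    "Jordan_Normal_Form.Char_Poly"
    "Jordan_Normal_Form.Gauss_Jordan_Elimination"
begin

abbreviation cmat :: "real mat \<Rightarrow> complex mat" where
  "cmat \<equiv> map_mat complex_of_real"

definition append_cols :: "'a :: zero mat \<Rightarrow> 'a mat \<Rightarrow> 'a mat" where
  "append_cols A B = four_block_mat A B (0\<^sub>m 0 (dim_col A)) (0\<^sub>m 0 (dim_col B))"

text \<open>\<open>mat_inverse\<close> returns an option; this value is meaningful for invertible matrices only.\<close>

definition inv_mat :: "complex mat \<Rightarrow> complex mat" where
  "inv_mat M = the (mat_inverse M)"

definition vec_norm2 :: "complex Matrix.vec \<Rightarrow> real" where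
  "vec_norm2 v = L2_set (\<lambda>i. cmod (vec_index v i)) {..<dim_vec v}"

definition op_norm :: "complex mat \<Rightarrow> real" where
  "op_norm M = Sup {vec_norm2 (M *\<^sub>v v) | v. v \<in> carrier_vec (dim_col M) \<and> vec_norm2 v \<le> 1}"

definition pos_def :: "real mat \<Rightarrow> bool" where
  "pos_def M \<longleftrightarrow> M \<in> carrier_mat (dim_row M) (dim_row M) \<and> transpose_mat M = M \<and>
     (\<forall>v \<in> carrier_vec (dim_row M). v \<noteq> 0\<^sub>v (dim_row M) \<longrightarrow> scalar_prod v (M *\<^sub>v v) > 0)"

definition full_column_rank :: "complex mat \<Rightarrow> bool" where
  "full_column_rank M \<longleftrightarrow> vec_space.rank (dim_row M) M = dim_col M"

definition hurwitz :: "real mat \<Rightarrow> bool" where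
  "hurwitz M \<longleftrightarrow> (\<forall>z. eigenvalue (cmat M) z \<longrightarrow> Re z < 0)"

definition stabilizable :: "real mat \<Rightarrow> real mat \<Rightarrow> bool" where
  "stabilizable A B \<longleftrightarrow> (\<exists>F \<in> carrier_mat (dim_col B) (dim_row A). hurwitz (A + B * F))"

definition riccati_assms :: "real mat \<Rightarrow> real mat \<Rightarrow> real mat \<Rightarrow> real mat \<Rightarrow> bool" where
  "riccati_assms A B C D \<longleftrightarrow>
     pos_def (transpose_mat D * D) \<and>
     stabilizable A B \<and>
     (\<forall>\<omega>::real. full_column_rank
        (four_block_mat (cmat A - (\<i> * complex_of_real \<omega>) \<cdot>\<^sub>m 1\<^sub>m (dim_row A)) (cmat B)
                        (cmat C) (cmat D)))"

text \<open>Agents are numbered \<open>0, \<dots>, N - 1\<close>. A partition is given by its block sizes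
  \<open>r 0, \<dots>, r (N - 1)\<close>; block \<open>i\<close> starts at index \<open>tot i r\<close>.\<close>

definition tot :: "nat \<Rightarrow> (nat \<Rightarrow> nat) \<Rightarrow> nat" where
  "tot N r = (\<Sum>i<N. r i)"

definition blk :: "(nat \<Rightarrow> nat) \<Rightarrow> (nat \<Rightarrow> nat) \<Rightarrow> 'a mat \<Rightarrow> nat \<Rightarrow> nat \<Rightarrow> 'a mat" where
  "blk r c M i j = Matrix.mat (r i) (c j) (\<lambda>(a, b). M $$ (tot i r + a, tot j c + b))"

definition block_diagonal ::
    "nat \<Rightarrow> (nat \<Rightarrow> nat) \<Rightarrow> (nat \<Rightarrow> nat) \<Rightarrow> 'a :: zero mat \<Rightarrow> bool" where
  "block_diagonal N r c M \<longleftrightarrow> M \<in> carrier_mat (tot N r) (tot N c) \<and>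
     (\<forall>i<N. \<forall>j<N. i \<noteq> j \<longrightarrow> blk r c M i j = 0\<^sub>m (r i) (c j))"

text \<open>A transfer matrix is a matrix-valued function of the Laplace variable that matters only on
  some right half plane \<open>{s. Re s > \<alpha>}\<close>. Accordingly, two transfer matrices are the same if
  they agree on such a half plane.\<close>

abbreviation right_half_planes :: "complex filter" where
  "right_half_planes \<equiv> filtercomap Re at_top"

definition tf_eq :: "(complex \<Rightarrow> complex mat) \<Rightarrow> (complex \<Rightarrow> complex mat) \<Rightarrow> bool"
    (infix \<open>\<approx>\<^sub>t\<^sub>f\<close> 50) where
  "G \<approx>\<^sub>t\<^sub>f H \<longleftrightarrow> (\<forall>\<^sub>F s in right_half_planes. G s = H s)"

definition analytic_bounded ::
    "nat \<Rightarrow> nat \<Rightarrow> real \<Rightarrow> (complex \<Rightarrow> complex mat) \<Rightarrow> bool" where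
  "analytic_bounded r c \<alpha> G \<longleftrightarrow>
     (\<forall>s. Re s > \<alpha> \<longrightarrow> G s \<in> carrier_mat r c) \<and>
     (\<forall>i<r. \<forall>j<c. (\<lambda>s. G s $$ (i, j)) holomorphic_on {s. Re s > \<alpha>}) \<and>
     bdd_above ((\<lambda>s. op_norm (G s)) ` {s. Re s > \<alpha>})"

definition H_inf :: "nat \<Rightarrow> nat \<Rightarrow> (complex \<Rightarrow> complex mat) set" where
  "H_inf r c = {G. analytic_bounded r c 0 G}"

definition L_prop :: "nat \<Rightarrow> nat \<Rightarrow> (complex \<Rightarrow> complex mat) set" where
  "L_prop r c = {G. \<exists>\<alpha>>0. analytic_bounded r c \<alpha> G}"

definition realization ::
    "real mat \<Rightarrow> real mat \<Rightarrow> real mat \<Rightarrow> real mat \<Rightarrow> complex \<Rightarrow> complex mat" where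
  "realization A B C D s =
     cmat D + cmat C * inv_mat (s \<cdot>\<^sub>m 1\<^sub>m (dim_row A) - cmat A) * cmat B"

text \<open>The lower channel of the first argument has the size determined by the second argument,
  with which it is interconnected.\<close>

definition lft :: "complex mat \<Rightarrow> complex mat \<Rightarrow> complex mat" where
  "lft J Q = (case split_block J (dim_row J - dim_col Q) (dim_col J - dim_row Q) of
     (J11, J12, J21, J22) \<Rightarrow>
       J11 + J12 * Q * inv_mat (1\<^sub>m (dim_row J22) - J22 * Q) * J21)"

definition lower_right :: "nat \<Rightarrow> nat \<Rightarrow> 'a mat \<Rightarrow> 'a mat" where
  "lower_right r c M = (case split_block M (dim_row M - r) (dim_col M - c) of
     (M11, M12, M21, M22) \<Rightarrow> M22)"

text \<open>The sizes \<open>m\<close> (inputs) and \<open>p\<close> (measurements) single out the (2,2) block of the plant.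
  The equation \<open>mat_inverse _ = Some _\<close> includes the invertibility of the matrix; it is
  understood as an equation of transfer matrices.\<close>

definition stabilizes ::
    "nat \<Rightarrow> nat \<Rightarrow> (complex \<Rightarrow> complex mat) \<Rightarrow> (complex \<Rightarrow> complex mat) \<Rightarrow> bool" where
  "stabilizes m p K P \<longleftrightarrow> (\<exists>H \<in> H_inf (p + m) (p + m). \<forall>\<^sub>F s in right_half_planes.
     mat_inverse (four_block_mat (1\<^sub>m p) (- lower_right p m (P s)) (- K s) (1\<^sub>m m)) = Some (H s))"

definition reaches :: "(nat \<times> nat) set \<Rightarrow> nat \<Rightarrow> nat \<Rightarrow> bool" where
  "reaches E j i \<longleftrightarrow> i \<noteq> j \<and> (j, i) \<in> E\<^sup>+"

definition S_delay ::
    "nat \<Rightarrow> (nat \<Rightarrow> nat) \<Rightarrow> (nat \<Rightarrow> nat) \<Rightarrow> (nat \<times> nat) set \<Rightarrow> real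
     \<Rightarrow> (complex \<Rightarrow> complex mat) set" where
  "S_delay N r c E \<tau> = {K. \<exists>Kb.
     (\<forall>i<N. \<forall>j<N. Kb i j \<in> L_prop (r i) (c j)) \<and>
     (\<forall>\<^sub>F s in right_half_planes. K s \<in> carrier_mat (tot N r) (tot N c) \<and>
       (\<forall>i<N. \<forall>j<N. blk r c (K s) i j =
          (if i = j then Kb i i s
           else if reaches E j i then exp (- s * complex_of_real \<tau>) \<cdot>\<^sub>m Kb i j s
           else 0\<^sub>m (r i) (c j))))}"

definition plant ::
    "real mat \<Rightarrow> real mat \<Rightarrow> real mat \<Rightarrow> real mat \<Rightarrow> real mat \<Rightarrow> real mat \<Rightarrow> real mat
     \<Rightarrow> complex \<Rightarrow> complex mat" where
  "plant A B1 B2 C1 C2 D12 D21 = realization A (append_cols B1 B2) (C1 @\<^sub>r C2)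
     (four_block_mat (0\<^sub>m (dim_row C1) (dim_col B1)) D12
                     D21 (0\<^sub>m (dim_row C2) (dim_col B2)))"

definition youla_J ::
    "real mat \<Rightarrow> real mat \<Rightarrow> real mat \<Rightarrow> real mat \<Rightarrow> real mat \<Rightarrow> complex \<Rightarrow> complex mat" where
  "youla_J A B2 C2 F L = realization (A + B2 * F + L * C2) (append_cols (- L) B2) (F @\<^sub>r (- C2))
     (four_block_mat (0\<^sub>m (dim_row F) (dim_col L)) (1\<^sub>m (dim_col B2))
                     (1\<^sub>m (dim_row C2)) (0\<^sub>m (dim_row C2) (dim_col B2)))"

end

theory Submission
  imports Defs "HOL-Real_Asymp.Real_Asymp"
begin

text \<open>
  The statement combines two facts that are proved independently of each other: the classical
  Youla parametrization of all stabilizing controllers, and the closure of \<open>S_delay\<close> under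
  the two substitutions \<open>Q \<mapsto> K\<close> and \<open>K \<mapsto> Q\<close>.

  The controller \<open>lft J Q\<close> is an observer. With plant state \<open>x\<close>, observer
  state \<open>\<xi>\<close> and \<open>v = Q (y - C\<^sub>2 \<xi>)\<close>, it applies \<open>u = F \<xi> + v\<close>. The estimation error
  \<open>\<epsilon> = x - \<xi>\<close> is governed by the Hurwitz matrix \<open>A + L C\<^sub>2\<close> alone, and \<open>x\<close> is governed by the
  Hurwitz matrix \<open>A + B\<^sub>2 F\<close> and driven by \<open>\<epsilon>\<close> and \<open>v\<close>. So all maps of the closed loop are
  compositions of \<open>Q\<close> with stable resolvents, and are in \<open>H_inf\<close> when \<open>Q\<close> is
  (\<open>closed_loop_from_parameter\<close>, \<open>stabilizing_if_parameter\<close>). Conversely, the relation between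
  \<open>y\<close>, \<open>u\<close>, \<open>v\<close> and \<open>e = y - C\<^sub>2 \<xi>\<close> can be solved for the map \<open>e \<mapsto> v\<close>: it is again a linear
  fractional transformation, now of \<open>K\<close>, whose coefficient has the state matrix \<open>A\<close>. Injecting
  suitable stable signals into the two disturbance inputs of the loop produces any prescribed \<open>e\<close>,
  which exhibits \<open>e \<mapsto> v\<close> as a stable function of the closed loop
  (\<open>parameter_from_closed_loop\<close>, \<open>controller_of_parameter\<close>, \<open>parameter_if_stabilizing\<close>).
  At a fixed frequency these arguments are identities between matrices. They are proved by
  following signals through the loop, and the lemma \<open>state_space_lft_signals\<close>, saying that signals
  that satisfy the equations of an interconnection are related by its linear fractional
  transformation, replaces all manipulations of inverses.

  For the information structure: since \<open>A\<close>, \<open>B\<^sub>2\<close>, \<open>C\<^sub>2\<close>, \<open>F\<close>, \<open>L\<close> are block-diagonal, so are the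
  coefficients of both linear fractional transformations. It remains to see that \<open>S_delay\<close> contains
  the proper block-diagonal matrices and is closed under sums, products, and the inverse
  \<open>(1 - Y K)\<^sup>-\<^sup>1\<close> for \<open>Y\<close> block-diagonal and strictly proper. An element of \<open>S_delay\<close> is
  \<open>K\<^sub>d + e\<^sup>-\<^sup>s\<^sup>\<tau> K\<^sub>o\<close> with \<open>K\<^sub>d\<close> block-diagonal and \<open>K\<^sub>o\<close> supported on the reflexive transitive
  closure of the graph (\<open>S_delay_iff\<close>). Products stay of this form because the closure is transitive
  and a second factor \<open>e\<^sup>-\<^sup>s\<^sup>\<tau>\<close> is bounded. For inverses, \<open>X = X\<^sub>d + e\<^sup>-\<^sup>s\<^sup>\<tau> X\<^sub>o\<close> satisfies
  \<open>(1 - X)\<^sup>-\<^sup>1 = (1 - X\<^sub>d)\<^sup>-\<^sup>1 + e\<^sup>-\<^sup>s\<^sup>\<tau> (1 - X\<^sub>d)\<^sup>-\<^sup>1 X\<^sub>o (1 - X)\<^sup>-\<^sup>1\<close>,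
  so that only the support of the inverses has to be determined (\<open>S_delay_inverse\<close>). Far to the right
  in the complex plane, all matrices to be inverted are diagonally dominant; one elementary estimate,
  \<open>dominant_system_bound\<close>, then gives their invertibility, bounds for the inverses, and the
  support of the inverses.
\<close>

section \<open>Bounded analytic functions on a half plane\<close>
definition bounded_hol :: "real \<Rightarrow> (complex \<Rightarrow> complex) \<Rightarrow> bool" where
  "bounded_hol \<alpha> f \<longleftrightarrow> f holomorphic_on {s. Re s > \<alpha>} \<and> bounded (f ` {s. Re s > \<alpha>})"

lemma bounded_holI:
  assumes "f holomorphic_on {s. Re s > \<alpha>}" and "\<And>s. Re s > \<alpha> \<Longrightarrow> cmod (f s) \<le> b"
  shows "bounded_hol \<alpha> f"
  using assms by (auto simp: bounded_hol_def bounded_iff)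

lemma bounded_hol_const: "bounded_hol \<alpha> (\<lambda>s. a)"
  by (rule bounded_holI) auto

lemma bounded_hol_add:
  assumes "bounded_hol \<alpha> f" "bounded_hol \<alpha> g"
  shows "bounded_hol \<alpha> (\<lambda>s. f s + g s)"
  using assms unfolding bounded_hol_def
  by (auto intro!: holomorphic_intros bounded_plus_comp)

lemma bounded_hol_mult:
  assumes "bounded_hol \<alpha> f" "bounded_hol \<alpha> g"
  shows "bounded_hol \<alpha> (\<lambda>s. f s * g s)"
proof -
  obtain a b where "\<And>s. Re s > \<alpha> \<Longrightarrow> cmod (f s) \<le> a" "\<And>s. Re s > \<alpha> \<Longrightarrow> cmod (g s) \<le> b"
    using assms by (auto simp: bounded_hol_def bounded_iff)
  then have "cmod (f s * g s) \<le> \<bar>a\<bar> * \<bar>b\<bar>" if "Re s > \<alpha>" for s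
    using that by (fastforce simp: norm_mult intro!: mult_mono intro: order_trans[OF _ abs_ge_self])
  then show ?thesis
    using assms by (auto simp: bounded_hol_def intro!: bounded_holI[unfolded bounded_hol_def] holomorphic_intros)
qed

lemma bounded_hol_uminus: "bounded_hol \<alpha> f \<Longrightarrow> bounded_hol \<alpha> (\<lambda>s. - f s)"
  using bounded_hol_mult[OF bounded_hol_const, of \<alpha> f "-1"] by simp

lemma bounded_hol_sum:
  assumes "\<And>i. i \<in> I \<Longrightarrow> bounded_hol \<alpha> (f i)"
  shows "bounded_hol \<alpha> (\<lambda>s. \<Sum>i\<in>I. f i s)"
  using assms by (induction I rule: infinite_finite_induct)
    (auto intro: bounded_hol_const bounded_hol_add)

lemma bounded_hol_cong:
  assumes "\<And>s. Re s > \<alpha> \<Longrightarrow> f s = g s"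
  shows "bounded_hol \<alpha> f \<longleftrightarrow> bounded_hol \<alpha> g"
proof -
  have "f ` {s. Re s > \<alpha>} = g ` {s. Re s > \<alpha>}" using assms by auto
  moreover have "f holomorphic_on {s. Re s > \<alpha>} \<longleftrightarrow> g holomorphic_on {s. Re s > \<alpha>}"
    using assms by (intro holomorphic_cong) auto
  ultimately show ?thesis by (simp add: bounded_hol_def)
qed

lemma bounded_hol_mono:
  assumes "bounded_hol \<alpha> f" "\<alpha> \<le> \<beta>"
  shows "bounded_hol \<beta> f"
proof -
  have "{s. Re s > \<beta>} \<subseteq> {s. Re s > \<alpha>}" using assms(2) by auto
  then show ?thesis
    using assms(1) unfolding bounded_hol_def
    by (meson bounded_subset holomorphic_on_subset image_mono)
qed

lemma bounded_hol_exp_delay: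
  assumes "\<tau> \<ge> 0" "\<alpha> \<ge> 0"
  shows "bounded_hol \<alpha> (\<lambda>s. exp (- s * complex_of_real \<tau>))"
  using assms by (intro bounded_holI[where b = 1] holomorphic_intros) (auto simp: norm_exp_eq_Re)

section \<open>Bounded analytic matrix functions\<close>

notation vec_index (infixl \<open>$v\<close> 100)

lemma index_mult_mat_sum:
  assumes "A \<in> carrier_mat r n" "B \<in> carrier_mat n c" "i < r" "j < c"
  shows "(A * B) $$ (i, j) = (\<Sum>k<n. A $$ (i, k) * B $$ (k, j))"
  using assms by (auto simp: scalar_prod_def lessThan_atLeast0)

text \<open>This crude bound makes the set in the definition of \<open>op_norm\<close> bounded, without which its
  supremum carries no information.\<close>
lemma vec_norm2_mult_le:
  assumes M: "M \<in> carrier_mat r c" and b: "\<And>i j. i < r \<Longrightarrow> j < c \<Longrightarrow> cmod (M $$ (i, j)) \<le> b"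
    and v: "v \<in> carrier_vec c" "vec_norm2 v \<le> 1"
  shows "vec_norm2 (M *\<^sub>v v) \<le> r * (c * b)"
proof -
  have vj: "cmod (v $v j) \<le> 1" if "j < c" for j
    using member_le_L2_set[of "{..<dim_vec v}" j "\<lambda>i. cmod (v $v i)"] that v
    by (auto simp: vec_norm2_def)
  have "cmod ((M *\<^sub>v v) $v i) \<le> c * b" if i: "i < r" for i
  proof -
    have "(M *\<^sub>v v) $v i = (\<Sum>j<c. M $$ (i, j) * v $v j)"
      using M v i by (auto simp: scalar_prod_def lessThan_atLeast0)
    also have "cmod \<dots> \<le> (\<Sum>j<c. b)"
    proof (rule sum_norm_le)
      fix j assume "j \<in> {..<c}"
      then have "cmod (M $$ (i, j)) * cmod (v $v j) \<le> cmod (M $$ (i, j)) * 1"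
        using vj by (intro mult_left_mono) auto
      then show "cmod (M $$ (i, j) * v $v j) \<le> b"
        using b[OF i, of j] \<open>j \<in> {..<c}\<close> by (simp add: norm_mult)
    qed
    finally show ?thesis by simp
  qed
  then have "(\<Sum>i<r. cmod ((M *\<^sub>v v) $v i)) \<le> (\<Sum>i<r. c * b)"
    by (intro sum_mono) auto
  moreover have "vec_norm2 (M *\<^sub>v v) \<le> (\<Sum>i<r. cmod ((M *\<^sub>v v) $v i))"
    using M by (auto simp: vec_norm2_def simp del: index_mult_mat_vec intro!: L2_set_le_sum)
  ultimately show ?thesis by simp
qed

lemma op_norm_le:
  assumes M: "M \<in> carrier_mat r c" and b: "\<And>i j. i < r \<Longrightarrow> j < c \<Longrightarrow> cmod (M $$ (i, j)) \<le> b"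
  shows "op_norm M \<le> r * (c * b)"
  unfolding op_norm_def
proof (rule cSup_least)
  have "vec_norm2 (0\<^sub>v c) = 0" by (simp add: vec_norm2_def L2_set_def)
  then show "{vec_norm2 (M *\<^sub>v v) |v. v \<in> carrier_vec (dim_col M) \<and> vec_norm2 v \<le> 1} \<noteq> {}"
    using M by (auto intro!: exI[of _ "0\<^sub>v c"])
qed (use M vec_norm2_mult_le[OF M b] in auto)

lemma entry_le_op_norm:
  assumes M: "M \<in> carrier_mat r c" and ij: "i < r" "j < c"
  shows "cmod (M $$ (i, j)) \<le> op_norm M"
proof -
  have u: "vec_norm2 (unit_vec c j) \<le> 1"
  proof -
    have "vec_norm2 (unit_vec c j) \<le> (\<Sum>i<c. cmod (unit_vec c j $v i))"
      by (auto simp: vec_norm2_def intro!: L2_set_le_sum)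
    also have "\<dots> = (\<Sum>i<c. if i = j then 1 else 0)"
      using ij by (intro sum.cong) (auto simp: unit_vec_def)
    finally show ?thesis using ij by simp
  qed
  define b where "b = Max ((\<lambda>(i, j). cmod (M $$ (i, j))) ` ({..<r} \<times> {..<c}))"
  have b: "cmod (M $$ (i, j)) \<le> b" if "i < r" "j < c" for i j
    unfolding b_def using that by (intro Max_ge) auto
  have "cmod (M $$ (i, j)) = cmod ((M *\<^sub>v unit_vec c j) $v i)"
    using M ij by auto
  also have "\<dots> \<le> vec_norm2 (M *\<^sub>v unit_vec c j)"
    using member_le_L2_set[of "{..<r}" i "\<lambda>i. cmod ((M *\<^sub>v unit_vec c j) $v i)"] ij M
    by (auto simp: vec_norm2_def simp del: index_mult_mat_vec)
  also have "\<dots> \<le> op_norm M"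
    unfolding op_norm_def
  proof (rule cSup_upper)
    show "bdd_above {vec_norm2 (M *\<^sub>v v) |v. v \<in> carrier_vec (dim_col M) \<and> vec_norm2 v \<le> 1}"
      using vec_norm2_mult_le[OF M b] M by (auto intro!: bdd_aboveI[where M = "r * (c * b)"])
  qed (use u M in auto)
  finally show ?thesis .
qed

text \<open>The operator norm lies between the largest modulus of an entry and a multiple of it.
  So analyticity and boundedness can both be checked entry by entry, and the closure properties
  below reduce to those of scalar functions.\<close>
lemma analytic_bounded_iff:
  "analytic_bounded r c \<alpha> G \<longleftrightarrow> (\<forall>s. Re s > \<alpha> \<longrightarrow> G s \<in> carrier_mat r c) \<and>
     (\<forall>i<r. \<forall>j<c. bounded_hol \<alpha> (\<lambda>s. G s $$ (i, j)))"
proof (intro iffI conjI allI impI)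
  assume G: "analytic_bounded r c \<alpha> G"
  then show "G s \<in> carrier_mat r c" if "Re s > \<alpha>" for s
    using that by (auto simp: analytic_bounded_def)
  fix i j assume ij: "i < r" "j < c"
  obtain b where b: "\<And>s. Re s > \<alpha> \<Longrightarrow> op_norm (G s) \<le> b"
    using G by (auto simp: analytic_bounded_def bdd_above_def)
  show "bounded_hol \<alpha> (\<lambda>s. G s $$ (i, j))"
    using G ij entry_le_op_norm[OF _ ij] b
    by (intro bounded_holI[where b = b]) (auto simp: analytic_bounded_def intro: order_trans)
next
  assume G: "(\<forall>s. Re s > \<alpha> \<longrightarrow> G s \<in> carrier_mat r c) \<and>
    (\<forall>i<r. \<forall>j<c. bounded_hol \<alpha> (\<lambda>s. G s $$ (i, j)))"
  then have "\<exists>b. \<forall>s. Re s > \<alpha> \<longrightarrow> cmod (G s $$ (i, j)) \<le> b" if "i < r" "j < c" for i j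
    using that by (auto simp: bounded_hol_def bounded_iff)
  then obtain b where b: "\<And>i j s. i < r \<Longrightarrow> j < c \<Longrightarrow> Re s > \<alpha> \<Longrightarrow> cmod (G s $$ (i, j)) \<le> b i j"
    by metis
  define m where "m = Max ((\<lambda>(i, j). b i j) ` ({..<r} \<times> {..<c}))"
  have m: "b i j \<le> m" if "i < r" "j < c" for i j
    unfolding m_def using that by (intro Max_ge) auto
  have "op_norm (G s) \<le> r * (c * m)" if "Re s > \<alpha>" for s
    using G that by (intro op_norm_le order_trans[OF b m]) auto
  then show "analytic_bounded r c \<alpha> G"
    using G by (auto simp: analytic_bounded_def bounded_hol_def bdd_above_def)
qed

lemma analytic_boundedI:
  assumes "\<And>s. Re s > \<alpha> \<Longrightarrow> G s \<in> carrier_mat r c"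
    and "\<And>i j. i < r \<Longrightarrow> j < c \<Longrightarrow> bounded_hol \<alpha> (\<lambda>s. G s $$ (i, j))"
  shows "analytic_bounded r c \<alpha> G"
  using assms by (simp add: analytic_bounded_iff)

lemma analytic_bounded_carrier:
  "analytic_bounded r c \<alpha> G \<Longrightarrow> Re s > \<alpha> \<Longrightarrow> G s \<in> carrier_mat r c"
  by (simp add: analytic_bounded_iff)

lemma analytic_bounded_entry:
  "analytic_bounded r c \<alpha> G \<Longrightarrow> i < r \<Longrightarrow> j < c \<Longrightarrow> bounded_hol \<alpha> (\<lambda>s. G s $$ (i, j))"
  by (simp add: analytic_bounded_iff)

lemma analytic_bounded_mono:
  "analytic_bounded r c \<alpha> G \<Longrightarrow> \<alpha> \<le> \<beta> \<Longrightarrow> analytic_bounded r c \<beta> G"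
  by (auto simp: analytic_bounded_iff intro: bounded_hol_mono)

lemma analytic_bounded_const: "M \<in> carrier_mat r c \<Longrightarrow> analytic_bounded r c \<alpha> (\<lambda>s. M)"
  by (simp add: analytic_bounded_iff bounded_hol_const)

lemma analytic_bounded_entrywise:
  assumes "\<And>s. Re s > \<alpha> \<Longrightarrow> G s \<in> carrier_mat r c"
    and "\<And>s i j. Re s > \<alpha> \<Longrightarrow> i < r \<Longrightarrow> j < c \<Longrightarrow> G s $$ (i, j) = g i j s"
    and "\<And>i j. i < r \<Longrightarrow> j < c \<Longrightarrow> bounded_hol \<alpha> (g i j)"
  shows "analytic_bounded r c \<alpha> G"
proof (rule analytic_boundedI)
  fix i j assume "i < r" "j < c"
  then show "bounded_hol \<alpha> (\<lambda>s. G s $$ (i, j))"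
    using bounded_hol_cong[of \<alpha> "\<lambda>s. G s $$ (i, j)" "g i j"] assms by auto
qed (use assms in auto)

lemma analytic_bounded_add:
  assumes "analytic_bounded r c \<alpha> G" "analytic_bounded r c \<alpha> H"
  shows "analytic_bounded r c \<alpha> (\<lambda>s. G s + H s)"
proof (rule analytic_bounded_entrywise)
  fix s i j assume "Re s > \<alpha>" "i < r" "j < c"
  then show "(G s + H s) $$ (i, j) = G s $$ (i, j) + H s $$ (i, j)"
    using assms[THEN analytic_bounded_carrier, of s] by auto
qed (use assms in \<open>auto intro!: add_carrier_mat bounded_hol_add dest: analytic_bounded_entry analytic_bounded_carrier\<close>)

lemma analytic_bounded_uminus:
  assumes "analytic_bounded r c \<alpha> G"
  shows "analytic_bounded r c \<alpha> (\<lambda>s. - G s)"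
proof (rule analytic_bounded_entrywise)
  fix s i j assume "Re s > \<alpha>" "i < r" "j < c"
  then show "(- G s) $$ (i, j) = - (G s $$ (i, j))"
    using assms[THEN analytic_bounded_carrier, of s] by auto
qed (use assms in \<open>auto intro: bounded_hol_uminus analytic_bounded_entry analytic_bounded_carrier\<close>)

lemma analytic_bounded_minus:
  assumes G: "analytic_bounded r c \<alpha> G" and H: "analytic_bounded r c \<alpha> H"
  shows "analytic_bounded r c \<alpha> (\<lambda>s. G s - H s)"
proof (rule analytic_bounded_entrywise)
  fix s i j assume "Re s > \<alpha>" "i < r" "j < c"
  then show "(G s - H s) $$ (i, j) = G s $$ (i, j) + - (H s $$ (i, j))"
    using assms[THEN analytic_bounded_carrier, of s] by auto
qed (use assms in \<open>auto intro!: minus_carrier_mat bounded_hol_add bounded_hol_uminus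
      dest: analytic_bounded_entry analytic_bounded_carrier simp del: add_uminus_conv_diff\<close>)

lemma analytic_bounded_mult:
  assumes "analytic_bounded r n \<alpha> G" "analytic_bounded n c \<alpha> H"
  shows "analytic_bounded r c \<alpha> (\<lambda>s. G s * H s)"
proof (rule analytic_bounded_entrywise)
  fix s i j assume "Re s > \<alpha>" "i < r" "j < c"
  then show "(G s * H s) $$ (i, j) = (\<Sum>k<n. G s $$ (i, k) * H s $$ (k, j))"
    using assms[THEN analytic_bounded_carrier, of s] by (intro index_mult_mat_sum)
qed (use assms in \<open>auto intro!: bounded_hol_sum bounded_hol_mult
       intro: mult_carrier_mat analytic_bounded_entry analytic_bounded_carrier\<close>)

lemma analytic_bounded_smult:
  assumes "bounded_hol \<alpha> f" "analytic_bounded r c \<alpha> G"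
  shows "analytic_bounded r c \<alpha> (\<lambda>s. f s \<cdot>\<^sub>m G s)"
proof (rule analytic_bounded_entrywise)
  fix s i j assume "Re s > \<alpha>" "i < r" "j < c"
  then show "(f s \<cdot>\<^sub>m G s) $$ (i, j) = f s * G s $$ (i, j)"
    using assms(2)[THEN analytic_bounded_carrier, of s] by auto
qed (use assms in \<open>auto intro!: smult_carrier_mat bounded_hol_mult dest: analytic_bounded_entry analytic_bounded_carrier\<close>)

lemmas analytic_bounded_intros =
  analytic_bounded_const analytic_bounded_add analytic_bounded_uminus analytic_bounded_minus
  analytic_bounded_mult analytic_bounded_smult

section \<open>Inverse matrices\<close>

lemma inv_mat_inverse:
  assumes M: "M \<in> carrier_mat n n" and d: "det M \<noteq> 0"
  shows "inv_mat M \<in> carrier_mat n n" "M * inv_mat M = 1\<^sub>m n" "inv_mat M * M = 1\<^sub>m n"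
    "mat_inverse M = Some (inv_mat M)"
proof -
  have "M \<in> Units (ring_mat TYPE(complex) n ())"
    using det_non_zero_imp_unit[OF M d] .
  then obtain H where H: "mat_inverse M = Some H"
    using mat_inverse(1)[OF M, of "()"] by fastforce
  show "inv_mat M \<in> carrier_mat n n" "M * inv_mat M = 1\<^sub>m n" "inv_mat M * M = 1\<^sub>m n"
     "mat_inverse M = Some (inv_mat M)"
    using mat_inverse(2)[OF M H] H by (auto simp: inv_mat_def)
qed

lemma det_nonzero_if_right_inverse:
  assumes "M \<in> carrier_mat n n" "H \<in> carrier_mat n n" "M * H = 1\<^sub>m n"
  shows "det (M :: 'a :: field mat) \<noteq> 0"
proof
  assume "det M = 0"
  then have "det (M * H) = 0" using det_mult[OF assms(1,2)] by simp
  then show False using assms(3) by simp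
qed

lemma inv_mat_eqI:
  assumes M: "M \<in> carrier_mat n n" and H: "H \<in> carrier_mat n n" and MH: "M * H = 1\<^sub>m n"
  shows "inv_mat M = H"
proof -
  note i = inv_mat_inverse[OF M det_nonzero_if_right_inverse[OF assms]]
  have "inv_mat M * (M * H) = inv_mat M" using i MH by simp
  moreover have "inv_mat M * (M * H) = inv_mat M * M * H"
    using i(1) M H by (subst assoc_mult_mat) auto
  ultimately show ?thesis using i H by simp
qed

text \<open>Cramer's rule shows that the inverse depends analytically on the matrix.\<close>
lemma inv_mat_cofactor:
  assumes M: "M \<in> carrier_mat n n" and d: "det M \<noteq> 0" and ij: "i < n" "j < n"
  shows "inv_mat M $$ (i, j) = cofactor M j i / det M"
proof -
  have "inv_mat M = (1 / det M) \<cdot>\<^sub>m adj_mat M"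
  proof (rule inv_mat_eqI[OF M])
    show "M * ((1 / det M) \<cdot>\<^sub>m adj_mat M) = 1\<^sub>m n"
      using adj_mat[OF M] M d by (auto simp: mult_smult_distrib)
  qed (use adj_mat[OF M] in auto)
  then show ?thesis using M ij by (auto simp: adj_mat_def)
qed

lemma holomorphic_on_det:
  assumes "\<And>s. s \<in> S \<Longrightarrow> G s \<in> carrier_mat n n"
    and "\<And>i j. i < n \<Longrightarrow> j < n \<Longrightarrow> (\<lambda>s. G s $$ (i, j)) holomorphic_on S"
  shows "(\<lambda>s. det (G s)) holomorphic_on S"
proof -
  have "(\<lambda>s. det (G s)) holomorphic_on S \<longleftrightarrow> (\<lambda>s. \<Sum>p | p permutes {0..<n}.
      signof p * (\<Prod>i = 0..<n. G s $$ (i, p i))) holomorphic_on S"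
    using assms(1) by (intro holomorphic_cong) (auto simp: det_def')
  also have \<dots>
    by (intro holomorphic_intros assms(2)) (auto simp: permutes_in_image[where S = "{0..<n}", simplified])
  finally show ?thesis .
qed

lemma holomorphic_on_inv_mat:
  assumes G: "\<And>s. s \<in> S \<Longrightarrow> G s \<in> carrier_mat n n"
    and hol: "\<And>i j. i < n \<Longrightarrow> j < n \<Longrightarrow> (\<lambda>s. G s $$ (i, j)) holomorphic_on S"
    and d: "\<And>s. s \<in> S \<Longrightarrow> det (G s) \<noteq> 0"
    and ij: "i < n" "j < n"
  shows "(\<lambda>s. inv_mat (G s) $$ (i, j)) holomorphic_on S"
proof -
  have "(\<lambda>s. inv_mat (G s) $$ (i, j)) holomorphic_on S \<longleftrightarrow>
    (\<lambda>s. (-1) ^ (j + i) * det (mat_delete (G s) j i) / det (G s)) holomorphic_on S"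
    using G d ij by (intro holomorphic_cong) (auto simp: inv_mat_cofactor[of _ n] cofactor_def)
  also have \<dots>
  proof (intro holomorphic_intros holomorphic_on_det[of S G n] G hol d)
    show "(\<lambda>s. det (mat_delete (G s) j i)) holomorphic_on S"
    proof (rule holomorphic_on_det)
      show "mat_delete (G s) j i \<in> carrier_mat (n - 1) (n - 1)" if "s \<in> S" for s
        using G[OF that] by (auto simp: mat_delete_def)
      fix a b assume ab: "a < n - 1" "b < n - 1"
      have "mat_delete (G s) j i $$ (a, b) =
        G s $$ (if a < j then a else Suc a, if b < i then b else Suc b)" if "s \<in> S" for s
        using G[OF that] ab by (auto simp: mat_delete_def)
      then have "(\<lambda>s. mat_delete (G s) j i $$ (a, b)) holomorphic_on S \<longleftrightarrow>
        (\<lambda>s. G s $$ (if a < j then a else Suc a, if b < i then b else Suc b)) holomorphic_on S"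
        by (intro holomorphic_cong) auto
      also have \<dots> using ab by (intro hol) auto
      finally show "(\<lambda>s. mat_delete (G s) j i $$ (a, b)) holomorphic_on S" .
    qed
  qed auto
  finally show ?thesis .
qed

section \<open>Matrix algebra for signals\<close>

text \<open>The hypotheses are equations between dimensions, which the simplifier decides by itself.
  Hypotheses \<open>M \<in> carrier_mat r c\<close> would leave it to guess dimensions that do not occur in the
  equation to be rewritten. So a matrix equation expands into products of atoms without annotations.\<close>
lemma mat_distribs:
  fixes A B C :: "'a :: ring mat"
  shows "dim_row B = dim_col A \<Longrightarrow> dim_row C = dim_col A \<Longrightarrow> dim_col B = dim_col C \<Longrightarrow>
      A * (B + C) = A * B + A * C"
    "dim_row B = dim_col A \<Longrightarrow> dim_row C = dim_col A \<Longrightarrow> dim_col B = dim_col C \<Longrightarrow>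
      A * (B - C) = A * B - A * C"
    "dim_row A = dim_row B \<Longrightarrow> dim_col A = dim_row C \<Longrightarrow> dim_col B = dim_row C \<Longrightarrow>
      (A + B) * C = A * C + B * C"
    "dim_row A = dim_row B \<Longrightarrow> dim_col A = dim_row C \<Longrightarrow> dim_col B = dim_row C \<Longrightarrow>
      (A - B) * C = A * C - B * C"
  by (auto intro!: mult_add_distrib_mat mult_minus_distrib_mat add_mult_distrib_mat minus_mult_distrib_mat)

lemma mat_mult_assoc:
  fixes A :: "'a :: semiring_0 mat"
  shows "dim_row B = dim_col A \<Longrightarrow> dim_row C = dim_col B \<Longrightarrow> A * B * C = A * (B * C)"
  by (auto intro!: assoc_mult_mat)

lemma smult_mat_distribs:
  fixes B C :: "'a :: ring mat"
  shows "dim_row B = dim_row C \<Longrightarrow> dim_col B = dim_col C \<Longrightarrow> k \<cdot>\<^sub>m (B + C) = k \<cdot>\<^sub>m B + k \<cdot>\<^sub>m C"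
    "dim_row B = dim_row C \<Longrightarrow> dim_col B = dim_col C \<Longrightarrow> k \<cdot>\<^sub>m (B - C) = k \<cdot>\<^sub>m B - k \<cdot>\<^sub>m C"
    "k \<cdot>\<^sub>m (- B) = - (k \<cdot>\<^sub>m B)"
  by (auto intro!: eq_matI simp: algebra_simps)

lemma mat_one_mult:
  fixes A :: "'a :: semiring_1 mat"
  shows "dim_row A = n \<Longrightarrow> 1\<^sub>m n * A = A" "dim_col A = n \<Longrightarrow> A * 1\<^sub>m n = A"
  by auto

lemma mat_uminus_mult:
  fixes A B :: "'a :: ring mat"
  shows "dim_row B = dim_col A \<Longrightarrow> - A * B = - (A * B)" "dim_row B = dim_col A \<Longrightarrow> A * - B = - (A * B)"
  by auto

lemma mat_mult_smult:
  fixes A B :: "'a :: comm_ring_1 mat"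
  shows "dim_row B = dim_col A \<Longrightarrow> A * (k \<cdot>\<^sub>m B) = k \<cdot>\<^sub>m (A * B)"
    "dim_row B = dim_col A \<Longrightarrow> k \<cdot>\<^sub>m A * B = k \<cdot>\<^sub>m (A * B)"
  by (auto intro!: mult_smult_distrib mult_smult_assoc_mat)

lemmas mat_expand = mat_mult_smult mat_distribs mat_mult_assoc smult_mat_distribs mat_one_mult mat_uminus_mult

section \<open>Diagonally dominant matrices\<close>

text \<open>In the row where \<open>\<bar>v\<^sub>i\<bar>\<close> is maximal, \<open>c v\<^sub>i\<close> dominates the sum. The lemma has three uses:
  with \<open>b = 0\<close> it shows that dominant matrices are invertible, with \<open>b\<close> a unit vector it
  bounds a column of the inverse, and with \<open>b = 0\<close> on a proper subset \<open>S\<close> of the indices it locates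
  zeros in the inverse.\<close>
lemma dominant_system_bound:
  fixes v :: "nat \<Rightarrow> complex"
  assumes S: "finite S" "i \<in> S" and a: "a < cmod c"
    and eq: "\<And>i. i \<in> S \<Longrightarrow> c * v i = b i + (\<Sum>k\<in>S. X i k * v k)"
    and X: "\<And>i. i \<in> S \<Longrightarrow> (\<Sum>k\<in>S. cmod (X i k)) \<le> a"
    and b: "\<And>i. i \<in> S \<Longrightarrow> cmod (b i) \<le> \<beta>"
  shows "cmod (v i) \<le> \<beta> / (cmod c - a)"
proof -
  define \<mu> where "\<mu> = Max ((\<lambda>i. cmod (v i)) ` S)"
  have \<mu>: "cmod (v k) \<le> \<mu>" if "k \<in> S" for k
    unfolding \<mu>_def using that S by (intro Max_ge) auto
  have "\<mu> \<in> (\<lambda>i. cmod (v i)) ` S"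
    unfolding \<mu>_def using S by (intro Max_in) auto
  then obtain m where m: "m \<in> S" "cmod (v m) = \<mu>" by auto
  have "cmod c * \<mu> = cmod (b m + (\<Sum>k\<in>S. X m k * v k))"
    using eq[OF m(1)] m(2) by (metis norm_mult)
  also have "\<dots> \<le> \<beta> + (\<Sum>k\<in>S. cmod (X m k) * \<mu>)"
    using b[OF m(1)] \<mu>
    by (intro order_trans[OF norm_triangle_ineq] add_mono sum_norm_le)
       (auto simp: norm_mult intro: mult_left_mono)
  also have "\<dots> = \<beta> + (\<Sum>k\<in>S. cmod (X m k)) * \<mu>" by (simp add: sum_distrib_right)
  also have "\<dots> \<le> \<beta> + a * \<mu>"
    using X[OF m(1)] m(2) by (auto intro!: mult_right_mono)
  finally have "\<mu> \<le> \<beta> / (cmod c - a)" using a by (simp add: field_simps)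
  then show ?thesis using \<mu>[OF S(2)] by simp
qed

definition row_sums_le :: "complex mat \<Rightarrow> real \<Rightarrow> bool" where
  "row_sums_le X a \<longleftrightarrow> (\<forall>i<dim_row X. (\<Sum>k<dim_col X. cmod (X $$ (i, k))) \<le> a)"


lemma one_smult_mat: "1 \<cdot>\<^sub>m (A :: 'a :: monoid_mult mat) = A"
  by auto

lemma shifted_mult_vec:
  fixes X :: "complex mat"
  assumes "X \<in> carrier_mat n n" "v \<in> carrier_vec n" "i < n"
  shows "((c \<cdot>\<^sub>m 1\<^sub>m n - X) *\<^sub>v v) $v i = c * v $v i - (X *\<^sub>v v) $v i"
proof -
  have "(c \<cdot>\<^sub>m 1\<^sub>m n) *\<^sub>v v = c \<cdot>\<^sub>v v"
    using assms(2) by (intro eq_vecI) (auto simp: smult_scalar_prod_distrib[of _ n] row_one)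
  then have "(c \<cdot>\<^sub>m 1\<^sub>m n - X) *\<^sub>v v = c \<cdot>\<^sub>v v - X *\<^sub>v v"
    using assms by (simp add: minus_mult_distrib_mat_vec[of _ n n])
  then show ?thesis using assms by simp
qed

lemma det_dominant_nonzero:
  assumes X: "X \<in> carrier_mat n n" "row_sums_le X a" and a: "a < cmod c"
  shows "det (c \<cdot>\<^sub>m 1\<^sub>m n - X) \<noteq> 0"
proof
  assume "det (c \<cdot>\<^sub>m 1\<^sub>m n - X) = 0"
  moreover have M: "c \<cdot>\<^sub>m 1\<^sub>m n - X \<in> carrier_mat n n" using X by auto
  ultimately obtain v where v: "v \<in> carrier_vec n" "v \<noteq> 0\<^sub>v n" "(c \<cdot>\<^sub>m 1\<^sub>m n - X) *\<^sub>v v = 0\<^sub>v n"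
    by (auto simp: det_0_iff_vec_prod_zero[OF M])
  have eq: "c * v $v i = 0 + (\<Sum>k<n. X $$ (i, k) * v $v k)" if "i < n" for i
    using shifted_mult_vec[OF X(1) v(1) that, of c] X v that
    by (auto simp: scalar_prod_def lessThan_atLeast0)
  have "cmod (v $v i) \<le> 0 / (cmod c - a)" if "i < n" for i
    using X that eq
    by (intro dominant_system_bound[of "{..<n}" i a c "\<lambda>i. v $v i" "\<lambda>_. 0" "\<lambda>i k. X $$ (i, k)"] a)
       (auto simp: row_sums_le_def)
  then have "v = 0\<^sub>v n" using v(1) by (intro eq_vecI) auto
  then show False using v(2) by simp
qed

lemma inv_shifted_entry:
  assumes X: "X \<in> carrier_mat n n" and d: "det (c \<cdot>\<^sub>m 1\<^sub>m n - X) \<noteq> 0" and ij: "i < n" "j < n"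
  defines "R \<equiv> inv_mat (c \<cdot>\<^sub>m 1\<^sub>m n - X)"
  shows "c * R $$ (i, j) = (if i = j then 1 else 0) + (\<Sum>k<n. X $$ (i, k) * R $$ (k, j))"
proof -
  have M: "c \<cdot>\<^sub>m 1\<^sub>m n - X \<in> carrier_mat n n" using X by auto
  note R = inv_mat_inverse[OF M d, folded R_def]
  have "c \<cdot>\<^sub>m R - X * R = 1\<^sub>m n"
    using R(2) R(1) X by (simp add: minus_mult_distrib_mat[of _ n n] mult_smult_assoc_mat[of _ n n])
  then have "(c \<cdot>\<^sub>m R - X * R) $$ (i, j) = 1\<^sub>m n $$ (i, j)" by simp
  then show ?thesis using R(1) X ij
    by (simp add: index_mult_mat_sum[OF X R(1) ij] algebra_simps del: index_mult_mat(1) split: if_splits)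
qed

lemma inv_dominant_bound:
  assumes X: "X \<in> carrier_mat n n" "row_sums_le X a" and a: "a < cmod c" and ij: "i < n" "j < n"
  shows "cmod (inv_mat (c \<cdot>\<^sub>m 1\<^sub>m n - X) $$ (i, j)) \<le> 1 / (cmod c - a)"
proof -
  note eq = inv_shifted_entry[OF X(1) det_dominant_nonzero[OF X a] _ ij(2)]
  have row: "(\<Sum>k<n. cmod (X $$ (i, k))) \<le> a" if "i < n" for i
    using X that by (auto simp: row_sums_le_def)
  show ?thesis
    by (rule dominant_system_bound[OF _ _ a eq row]) (use ij in auto)
qed

text \<open>Fix a column \<open>j\<close> of the inverse, and let \<open>S\<close> be the rows \<open>i\<close> that \<open>j\<close> does not reach.
  By transitivity, a row in \<open>S\<close> has no nonzero coefficient outside \<open>S\<close>, and by reflexivity the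
  right hand side vanishes on \<open>S\<close>. So the entries in \<open>S\<close> solve a homogeneous dominant system.\<close>
lemma inv_dominant_pattern:
  assumes X: "X \<in> carrier_mat n n" "row_sums_le X a" and a: "a < cmod c"
    and \<rho>: "reflp \<rho>" "transp \<rho>"
    and pat: "\<And>i k. i < n \<Longrightarrow> k < n \<Longrightarrow> X $$ (i, k) \<noteq> 0 \<Longrightarrow> \<rho> (f k) (f i)"
    and ij: "i < n" "j < n" and nz: "inv_mat (c \<cdot>\<^sub>m 1\<^sub>m n - X) $$ (i, j) \<noteq> 0"
  shows "\<rho> (f j) (f i)"
proof (rule ccontr)
  define R where "R = inv_mat (c \<cdot>\<^sub>m 1\<^sub>m n - X)"
  define S where "S = {i. i < n \<and> \<not> \<rho> (f j) (f i)}"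
  assume "\<not> \<rho> (f j) (f i)"
  then have i: "i \<in> S" using ij by (simp add: S_def)
  have eq: "c * R $$ (i, j) = 0 + (\<Sum>k\<in>S. X $$ (i, k) * R $$ (k, j))" if "i \<in> S" for i
  proof -
    have i: "i < n" "\<not> \<rho> (f j) (f i)" using that by (auto simp: S_def)
    then have "i \<noteq> j" using \<rho>(1) by (auto dest: reflpD)
    then have "c * R $$ (i, j) = (\<Sum>k<n. X $$ (i, k) * R $$ (k, j))"
      using inv_shifted_entry[OF X(1) det_dominant_nonzero[OF X a] i(1) ij(2)] by (simp add: R_def)
    also have "\<dots> = (\<Sum>k\<in>S. X $$ (i, k) * R $$ (k, j))"
      using i pat[OF i(1)] transpD[OF \<rho>(2)]
      by (intro sum.mono_neutral_right) (auto simp: S_def)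
    finally show ?thesis by simp
  qed
  have sub: "(\<Sum>k\<in>S. cmod (X $$ (i, k))) \<le> a" if "i \<in> S" for i
  proof -
    have "(\<Sum>k\<in>S. cmod (X $$ (i, k))) \<le> (\<Sum>k<n. cmod (X $$ (i, k)))"
      by (intro sum_mono2) (auto simp: S_def)
    then show ?thesis using X that by (auto simp: row_sums_le_def S_def)
  qed
  have "cmod (R $$ (i, j)) \<le> 0 / (cmod c - a)"
    by (rule dominant_system_bound[OF _ i a eq sub]) (auto simp: S_def)
  then show False using nz by (simp add: R_def)
qed

section \<open>Proper and strictly proper transfer matrices\<close>

text \<open>The additional bound \<open>\<alpha> > 0\<close> matches the definition of \<open>L_prop\<close> and makes the delay factor
  bounded on the half plane.\<close>
lemma eventually_right_half_planes:
  "(\<forall>\<^sub>F s in right_half_planes. P s) \<longleftrightarrow> (\<exists>\<alpha>>0. \<forall>s. Re s > \<alpha> \<longrightarrow> P s)"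
proof
  assume "\<forall>\<^sub>F s in right_half_planes. P s"
  then obtain b where b: "\<And>s. Re s > b \<Longrightarrow> P s"
    by (auto simp: eventually_filtercomap eventually_at_top_dense)
  show "\<exists>\<alpha>>0. \<forall>s. Re s > \<alpha> \<longrightarrow> P s"
    using b by (intro exI[of _ "max b 1"]) auto
qed (auto simp: eventually_filtercomap eventually_at_top_dense)

lemma eventually_Re_gt: "\<forall>\<^sub>F s in right_half_planes. Re s > \<alpha>"
  unfolding eventually_right_half_planes by (intro exI[of _ "max \<alpha> 1"]) auto

lemma L_prop_iff: "G \<in> L_prop r c \<longleftrightarrow> (\<exists>\<alpha>. analytic_bounded r c \<alpha> G)"
proof
  assume "\<exists>\<alpha>. analytic_bounded r c \<alpha> G"
  then obtain \<alpha> where "analytic_bounded r c \<alpha> G" ..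
  then have "analytic_bounded r c (max \<alpha> 1) G" by (rule analytic_bounded_mono) simp
  then show "G \<in> L_prop r c" by (auto simp: L_prop_def intro: exI[of _ "max \<alpha> 1"])
qed (auto simp: L_prop_def)

lemma L_prop_entrywise:
  assumes car: "\<And>s. G s \<in> carrier_mat r c"
    and ent: "\<And>i j. i < r \<Longrightarrow> j < c \<Longrightarrow> \<exists>\<alpha>. bounded_hol \<alpha> (\<lambda>s. G s $$ (i, j))"
  shows "G \<in> L_prop r c"
proof -
  obtain \<alpha> where \<alpha>: "\<And>i j. i < r \<Longrightarrow> j < c \<Longrightarrow> bounded_hol (\<alpha> i j) (\<lambda>s. G s $$ (i, j))"
    using ent by metis
  define m where "m = Max ((\<lambda>(i, j). \<alpha> i j) ` ({..<r} \<times> {..<c}))"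
  have m: "\<alpha> i j \<le> m" if "i < r" "j < c" for i j
    unfolding m_def using that by (intro Max_ge) auto
  have "analytic_bounded r c m G"
    using car bounded_hol_mono[OF \<alpha> m] by (auto simp: analytic_bounded_iff)
  then show ?thesis unfolding L_prop_iff ..
qed

lemma L_prop_entry: "G \<in> L_prop r c \<Longrightarrow> i < r \<Longrightarrow> j < c \<Longrightarrow> \<exists>\<alpha>. bounded_hol \<alpha> (\<lambda>s. G s $$ (i, j))"
  by (auto simp: L_prop_iff analytic_bounded_iff)

lemma L_prop_cong:
  assumes "G \<in> L_prop r c" "\<forall>\<^sub>F s in right_half_planes. H s = G s"
  shows "H \<in> L_prop r c"
proof -
  obtain \<alpha> where \<alpha>: "analytic_bounded r c \<alpha> G" using assms(1) by (auto simp: L_prop_iff)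
  obtain \<beta> where \<beta>: "\<And>s. Re s > \<beta> \<Longrightarrow> H s = G s"
    using assms(2) by (auto simp: eventually_right_half_planes)
  have "analytic_bounded r c (max \<alpha> \<beta>) G" using \<alpha> by (rule analytic_bounded_mono) simp
  then have "analytic_bounded r c (max \<alpha> \<beta>) H"
    using \<beta> by (intro analytic_bounded_entrywise[where g = "\<lambda>i j s. G s $$ (i, j)"])
      (auto simp: analytic_bounded_iff)
  then show ?thesis unfolding L_prop_iff ..
qed

lemma L_prop_eventually_carrier:
  "G \<in> L_prop r c \<Longrightarrow> \<forall>\<^sub>F s in right_half_planes. G s \<in> carrier_mat r c"
  by (auto simp: L_prop_def eventually_right_half_planes analytic_bounded_iff)

lemma H_inf_subset_L_prop: "H_inf r c \<subseteq> L_prop r c"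
  by (auto simp: H_inf_def L_prop_iff)

lemma L_prop_const: "M \<in> carrier_mat r c \<Longrightarrow> (\<lambda>s. M) \<in> L_prop r c"
  unfolding L_prop_iff by (blast intro: analytic_bounded_const)

lemma L_prop_binary:
  assumes "G \<in> L_prop r c" "H \<in> L_prop r' c'"
    and "\<And>\<alpha>. \<alpha> \<ge> 0 \<Longrightarrow> analytic_bounded r c \<alpha> G \<Longrightarrow> analytic_bounded r' c' \<alpha> H \<Longrightarrow>
      analytic_bounded r'' c'' \<alpha> K"
  shows "K \<in> L_prop r'' c''"
proof -
  obtain \<alpha> \<beta> where "\<alpha> > 0" "analytic_bounded r c \<alpha> G" "\<beta> > 0" "analytic_bounded r' c' \<beta> H"
    using assms(1,2) by (auto simp: L_prop_def)
  then have "analytic_bounded r'' c'' (max \<alpha> \<beta>) K"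
    by (intro assms(3) analytic_bounded_mono[of _ _ \<alpha> _ "max \<alpha> \<beta>"]
        analytic_bounded_mono[of _ _ \<beta> _ "max \<alpha> \<beta>"]) auto
  then show ?thesis unfolding L_prop_iff ..
qed

lemma L_prop_add: "G \<in> L_prop r c \<Longrightarrow> H \<in> L_prop r c \<Longrightarrow> (\<lambda>s. G s + H s) \<in> L_prop r c"
  by (erule L_prop_binary, assumption) (rule analytic_bounded_add)

lemma L_prop_mult: "G \<in> L_prop r n \<Longrightarrow> H \<in> L_prop n c \<Longrightarrow> (\<lambda>s. G s * H s) \<in> L_prop r c"
  by (erule L_prop_binary, assumption) (rule analytic_bounded_mult)

lemma L_prop_delay:
  assumes "\<tau> \<ge> 0" "G \<in> L_prop r c"
  shows "(\<lambda>s. exp (- s * complex_of_real \<tau>) \<cdot>\<^sub>m G s) \<in> L_prop r c"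
  using assms(2,2) by (rule L_prop_binary) (intro analytic_bounded_smult bounded_hol_exp_delay assms)

lemma L_prop_entry_bounded:
  assumes "G \<in> L_prop r c" "i < r" "j < c"
  shows "\<exists>b. \<forall>\<^sub>F s in right_half_planes. cmod (G s $$ (i, j)) \<le> b"
proof -
  obtain \<alpha> where \<alpha>: "\<alpha> > 0" "analytic_bounded r c \<alpha> G" using assms by (auto simp: L_prop_def)
  then have "bounded_hol \<alpha> (\<lambda>s. G s $$ (i, j))" using assms by (auto simp: analytic_bounded_iff)
  then obtain b where "\<forall>s. Re s > \<alpha> \<longrightarrow> cmod (G s $$ (i, j)) \<le> b"
    by (auto simp: bounded_hol_def bounded_iff)
  then show ?thesis using \<alpha> by (auto simp: eventually_right_half_planes)
qed

text \<open>Strictly proper transfer matrices. They are what makes feedback loops well-posed: their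
  product with a proper matrix is small far to the right.\<close>
definition vanishing :: "nat \<Rightarrow> nat \<Rightarrow> (complex \<Rightarrow> complex mat) \<Rightarrow> bool" where
  "vanishing r c G \<longleftrightarrow> G \<in> L_prop r c \<and>
     (\<forall>i<r. \<forall>j<c. ((\<lambda>s. G s $$ (i, j)) \<longlongrightarrow> 0) right_half_planes)"

lemma vanishing_mult_right:
  assumes G: "vanishing r n G" and H: "H \<in> L_prop n c"
  shows "vanishing r c (\<lambda>s. G s * H s)"
  unfolding vanishing_def
proof (intro conjI allI impI)
  show "(\<lambda>s. G s * H s) \<in> L_prop r c" using assms by (auto simp: vanishing_def intro: L_prop_mult)
  fix i j assume ij: "i < r" "j < c"
  have car: "\<forall>\<^sub>F s in right_half_planes. G s \<in> carrier_mat r n \<and> H s \<in> carrier_mat n c"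
    using assms by (auto simp: vanishing_def intro: eventually_conj L_prop_eventually_carrier)
  have "((\<lambda>s. \<Sum>k<n. G s $$ (i, k) * H s $$ (k, j)) \<longlongrightarrow> 0) right_half_planes"
  proof (rule tendsto_null_sum)
    fix k assume k: "k \<in> {..<n}"
    then obtain b where "\<forall>\<^sub>F s in right_half_planes. cmod (H s $$ (k, j)) \<le> b"
      using L_prop_entry_bounded[OF H] ij by blast
    then show "((\<lambda>s. G s $$ (i, k) * H s $$ (k, j)) \<longlongrightarrow> 0) right_half_planes"
      using G ij k by (intro lim_null_mult_right_bounded) (auto simp: vanishing_def)
  qed
  moreover have "\<forall>\<^sub>F s in right_half_planes. (\<Sum>k<n. G s $$ (i, k) * H s $$ (k, j)) = (G s * H s) $$ (i, j)"
    using car by eventually_elim (rule index_mult_mat_sum[symmetric]; use ij in simp)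
  ultimately show "((\<lambda>s. (G s * H s) $$ (i, j)) \<longlongrightarrow> 0) right_half_planes"
    by (rule Lim_transform_eventually)
qed

lemma vanishing_mult_left:
  assumes G: "G \<in> L_prop r n" and H: "vanishing n c H"
  shows "vanishing r c (\<lambda>s. G s * H s)"
  unfolding vanishing_def
proof (intro conjI allI impI)
  show "(\<lambda>s. G s * H s) \<in> L_prop r c" using assms by (auto simp: vanishing_def intro: L_prop_mult)
  fix i j assume ij: "i < r" "j < c"
  have car: "\<forall>\<^sub>F s in right_half_planes. G s \<in> carrier_mat r n \<and> H s \<in> carrier_mat n c"
    using assms by (auto simp: vanishing_def intro: eventually_conj L_prop_eventually_carrier)
  have "((\<lambda>s. \<Sum>k<n. G s $$ (i, k) * H s $$ (k, j)) \<longlongrightarrow> 0) right_half_planes"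
  proof (rule tendsto_null_sum)
    fix k assume k: "k \<in> {..<n}"
    then obtain b where "\<forall>\<^sub>F s in right_half_planes. cmod (G s $$ (i, k)) \<le> b"
      using L_prop_entry_bounded[OF G] ij by blast
    then show "((\<lambda>s. G s $$ (i, k) * H s $$ (k, j)) \<longlongrightarrow> 0) right_half_planes"
      using H ij k by (intro lim_null_mult_left_bounded) (auto simp: vanishing_def)
  qed
  moreover have "\<forall>\<^sub>F s in right_half_planes. (\<Sum>k<n. G s $$ (i, k) * H s $$ (k, j)) = (G s * H s) $$ (i, j)"
    using car by eventually_elim (rule index_mult_mat_sum[symmetric]; use ij in simp)
  ultimately show "((\<lambda>s. (G s * H s) $$ (i, j)) \<longlongrightarrow> 0) right_half_planes"
    by (rule Lim_transform_eventually)
qed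

text \<open>This turns strict properness into diagonal dominance of \<open>1 - X s\<close>.\<close>
lemma vanishing_row_sums:
  assumes X: "vanishing n n X" and a: "a > 0"
  shows "\<forall>\<^sub>F s in right_half_planes. X s \<in> carrier_mat n n \<and> row_sums_le (X s) a"
proof -
  have car: "\<forall>\<^sub>F s in right_half_planes. X s \<in> carrier_mat n n"
    using X by (auto simp: vanishing_def intro: L_prop_eventually_carrier)
  have "\<forall>\<^sub>F s in right_half_planes. \<forall>i\<in>{..<n}. (\<Sum>k<n. cmod (X s $$ (i, k))) < a"
  proof (rule eventually_ball_finite)
    show "\<forall>i\<in>{..<n}. \<forall>\<^sub>F s in right_half_planes. (\<Sum>k<n. cmod (X s $$ (i, k))) < a"
    proof
      fix i assume "i \<in> {..<n}"
      then have "((\<lambda>s. \<Sum>k<n. cmod (X s $$ (i, k))) \<longlongrightarrow> 0) right_half_planes"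
        using X by (intro tendsto_null_sum tendsto_norm_zero) (auto simp: vanishing_def)
      then show "\<forall>\<^sub>F s in right_half_planes. (\<Sum>k<n. cmod (X s $$ (i, k))) < a"
        using a by (rule order_tendstoD(2))
    qed
  qed simp
  with car show ?thesis
    by eventually_elim (auto simp: row_sums_le_def less_imp_le)
qed

lemma vanishing_inverse:
  assumes X: "vanishing n n X"
  shows "(\<lambda>s. inv_mat (1\<^sub>m n - X s)) \<in> L_prop n n"
proof -
  obtain \<alpha> where \<alpha>: "\<alpha> > 0" "analytic_bounded n n \<alpha> X" using X by (auto simp: vanishing_def L_prop_def)
  obtain \<beta> where \<beta>: "\<And>s. Re s > \<beta> \<Longrightarrow> X s \<in> carrier_mat n n \<and> row_sums_le (X s) (1/2)"
    using vanishing_row_sums[OF X, of "1/2"] by (auto simp: eventually_right_half_planes)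
  define \<gamma> where "\<gamma> = max \<alpha> \<beta>"
  have *: "X s \<in> carrier_mat n n" "row_sums_le (X s) (1/2)" "det (1\<^sub>m n - X s) \<noteq> 0" if "Re s > \<gamma>" for s
    using \<beta>[of s] that det_dominant_nonzero[of "X s" n "1/2" 1] by (auto simp: \<gamma>_def one_smult_mat)
  have hol: "(\<lambda>s. (1\<^sub>m n - X s) $$ (i, j)) holomorphic_on {s. Re s > \<gamma>}" if "i < n" "j < n" for i j
    using analytic_bounded_minus[OF analytic_bounded_const[of "1\<^sub>m n"] analytic_bounded_mono[OF \<alpha>(2), of \<gamma>]] that
    by (auto simp: analytic_bounded_def \<gamma>_def)
  have "analytic_bounded n n \<gamma> (\<lambda>s. inv_mat (1\<^sub>m n - X s))"
  proof (intro analytic_boundedI bounded_holI[where b = 2])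
    show "inv_mat (1\<^sub>m n - X s) \<in> carrier_mat n n" if "Re s > \<gamma>" for s
      using *[OF that] by (intro inv_mat_inverse(1)) auto
    fix i j assume ij: "i < n" "j < n"
    show "(\<lambda>s. inv_mat (1\<^sub>m n - X s) $$ (i, j)) holomorphic_on {s. Re s > \<gamma>}"
      using * hol ij by (intro holomorphic_on_inv_mat[of _ _ n] minus_carrier_mat) auto
    show "cmod (inv_mat (1\<^sub>m n - X s) $$ (i, j)) \<le> 2" if "Re s > \<gamma>" for s
      using inv_dominant_bound[of "X s" n "1/2" 1 i j] *[OF that] ij by (simp add: one_smult_mat)
  qed
  then show ?thesis unfolding L_prop_iff ..
qed

section \<open>Resolvents\<close>

lemma row_sums_le_exists: "\<exists>a\<ge>0. row_sums_le X a"
proof -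
  have "row_sums_le X (\<Sum>i<dim_row X. \<Sum>k<dim_col X. cmod (X $$ (i, k)))"
    by (auto simp: row_sums_le_def intro!: member_le_sum sum_nonneg)
  then show ?thesis by (meson sum_nonneg norm_ge_zero)
qed

lemma holomorphic_on_resolvent:
  assumes A: "A \<in> carrier_mat n n" and d: "\<And>s. s \<in> S \<Longrightarrow> det (s \<cdot>\<^sub>m 1\<^sub>m n - A) \<noteq> 0"
    and ij: "i < n" "j < n"
  shows "(\<lambda>s. inv_mat (s \<cdot>\<^sub>m 1\<^sub>m n - A) $$ (i, j)) holomorphic_on S"
proof (rule holomorphic_on_inv_mat[OF _ _ d ij])
  fix a b assume "a < n" "b < n"
  then have "(\<lambda>s. (s \<cdot>\<^sub>m 1\<^sub>m n - A) $$ (a, b)) = (\<lambda>s. s * (if a = b then 1 else 0) - A $$ (a, b))"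
    using A by auto
  then show "(\<lambda>s. (s \<cdot>\<^sub>m 1\<^sub>m n - A) $$ (a, b)) holomorphic_on S"
    by (simp only:) (intro holomorphic_intros)
qed (use A in auto)

lemma eventually_resolvent:
  assumes A: "A \<in> carrier_mat n n"
  shows "\<forall>\<^sub>F s in right_half_planes. det (s \<cdot>\<^sub>m 1\<^sub>m n - A) \<noteq> 0"
proof -
  obtain a where a: "row_sums_le A a" using row_sums_le_exists by blast
  show ?thesis using eventually_Re_gt[of a]
    by eventually_elim (use det_dominant_nonzero[OF A a] complex_Re_le_cmod order_less_le_trans in blast)
qed

lemma vanishing_resolvent:
  assumes A: "A \<in> carrier_mat n n"
  shows "vanishing n n (\<lambda>s. inv_mat (s \<cdot>\<^sub>m 1\<^sub>m n - A))"
proof -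
  obtain a where a: "row_sums_le A a" "a \<ge> 0" using row_sums_le_exists by blast
  have gt: "a < cmod s" if "Re s > a" for s
    using that complex_Re_le_cmod[of s] by linarith
  note d = det_dominant_nonzero[OF A a(1) gt]
  have bound: "cmod (inv_mat (s \<cdot>\<^sub>m 1\<^sub>m n - A) $$ (i, j)) \<le> 1 / (Re s - a)" if "Re s > a" "i < n" "j < n" for s i j
  proof -
    have "1 / (cmod s - a) \<le> 1 / (Re s - a)"
      using that complex_Re_le_cmod[of s] by (intro divide_left_mono mult_pos_pos) auto
    then show ?thesis using inv_dominant_bound[OF A a(1) gt that(2,3)] that by force
  qed
  have "analytic_bounded n n (a + 1) (\<lambda>s. inv_mat (s \<cdot>\<^sub>m 1\<^sub>m n - A))"
  proof (intro analytic_boundedI bounded_holI[where b = 1])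
    show "inv_mat (s \<cdot>\<^sub>m 1\<^sub>m n - A) \<in> carrier_mat n n" if "Re s > a + 1" for s
      using A d[of s] that by (intro inv_mat_inverse(1)) auto
    fix i j assume ij: "i < n" "j < n"
    show "(\<lambda>s. inv_mat (s \<cdot>\<^sub>m 1\<^sub>m n - A) $$ (i, j)) holomorphic_on {s. Re s > a + 1}"
      using d ij by (intro holomorphic_on_resolvent[OF A]) auto
    show "cmod (inv_mat (s \<cdot>\<^sub>m 1\<^sub>m n - A) $$ (i, j)) \<le> 1" if "Re s > a + 1" for s
      using order_trans[OF bound[of s i j]] ij that by simp
  qed
  moreover have "((\<lambda>s. inv_mat (s \<cdot>\<^sub>m 1\<^sub>m n - A) $$ (i, j)) \<longlongrightarrow> 0) right_half_planes" if ij: "i < n" "j < n" for i j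
  proof (rule Lim_null_comparison)
    show "\<forall>\<^sub>F s in right_half_planes. cmod (inv_mat (s \<cdot>\<^sub>m 1\<^sub>m n - A) $$ (i, j)) \<le> 1 / (Re s - a)"
      using eventually_Re_gt[of a] by eventually_elim (use bound ij in auto)
    have "((\<lambda>x. 1 / (x - a)) \<longlongrightarrow> 0) at_top" by real_asymp
    then show "((\<lambda>s. 1 / (Re s - a)) \<longlongrightarrow> 0) right_half_planes"
      by (rule filterlim_compose) (rule filterlim_filtercomap)
  qed
  ultimately show ?thesis by (auto simp: vanishing_def L_prop_iff)
qed

lemma hurwitz_det_nonzero:
  assumes A: "A \<in> carrier_mat n n" and h: "hurwitz A" and s: "Re s \<ge> 0"
  shows "det (s \<cdot>\<^sub>m 1\<^sub>m n - cmat A) \<noteq> 0"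
proof
  assume "det (s \<cdot>\<^sub>m 1\<^sub>m n - cmat A) = 0"
  moreover have M: "s \<cdot>\<^sub>m 1\<^sub>m n - cmat A \<in> carrier_mat n n" using A by auto
  ultimately obtain v where v: "v \<in> carrier_vec n" "v \<noteq> 0\<^sub>v n" "(s \<cdot>\<^sub>m 1\<^sub>m n - cmat A) *\<^sub>v v = 0\<^sub>v n"
    by (auto simp: det_0_iff_vec_prod_zero[OF M])
  have "cmat A *\<^sub>v v = s \<cdot>\<^sub>v v"
  proof (rule eq_vecI)
    fix i assume "i < dim_vec (s \<cdot>\<^sub>v v)"
    then have i: "i < n" using v by auto
    then show "(cmat A *\<^sub>v v) $v i = (s \<cdot>\<^sub>v v) $v i"
      using shifted_mult_vec[of "cmat A" n v i s] A v by (simp del: index_mult_mat_vec)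
  qed (use A v in auto)
  then have "eigenvalue (cmat A) s"
    using A v unfolding eigenvalue_def eigenvector_def by auto
  then show False using h s by (auto simp: hurwitz_def)
qed

text \<open>Outside a large disc the resolvent is bounded by diagonal dominance. The rest of the closed
  right half plane is compact, and the resolvent is continuous there because the imaginary axis
  contains no eigenvalue.\<close>
lemma hurwitz_resolvent_H_inf:
  assumes A: "A \<in> carrier_mat n n" and h: "hurwitz A"
  shows "(\<lambda>s. inv_mat (s \<cdot>\<^sub>m 1\<^sub>m n - cmat A)) \<in> H_inf n n"
  unfolding H_inf_def mem_Collect_eq
proof (rule analytic_boundedI)
  have cA: "cmat A \<in> carrier_mat n n" using A by auto
  note d = hurwitz_det_nonzero[OF A h]
  show "inv_mat (s \<cdot>\<^sub>m 1\<^sub>m n - cmat A) \<in> carrier_mat n n" if "Re s > 0" for s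
    using cA d[of s] that by (intro inv_mat_inverse(1)) auto
  fix i j assume ij: "i < n" "j < n"
  let ?f = "\<lambda>s. inv_mat (s \<cdot>\<^sub>m 1\<^sub>m n - cmat A) $$ (i, j)"
  obtain a where a: "row_sums_le (cmat A) a" "a \<ge> 0" using row_sums_le_exists by blast
  define C where "C = cball 0 (a + 1) \<inter> {s. Re s \<ge> 0}"
  have "compact C" unfolding C_def by (intro compact_Int_closed compact_cball closed_halfspace_Re_ge)
  moreover have "?f holomorphic_on {s. Re s \<ge> 0}"
    using d ij by (intro holomorphic_on_resolvent[OF cA]) auto
  then have "continuous_on C ?f"
    by (rule continuous_on_subset[OF holomorphic_on_imp_continuous_on]) (auto simp: C_def)
  ultimately have "bounded (?f ` C)" by (intro compact_imp_bounded compact_continuous_image)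
  then obtain b where b: "\<And>s. s \<in> C \<Longrightarrow> cmod (?f s) \<le> b" by (auto simp: bounded_iff)
  show "bounded_hol 0 ?f"
  proof (rule bounded_holI)
    show "?f holomorphic_on {s. Re s > 0}"
      using d ij by (intro holomorphic_on_resolvent[OF cA]) auto
    show "cmod (?f s) \<le> max b 1" if s: "Re s > 0" for s
    proof (cases "s \<in> C")
      case False
      then have s1: "cmod s > a + 1" using s by (auto simp: C_def)
      then have "cmod (?f s) \<le> 1 / (cmod s - a)"
        by (intro inv_dominant_bound[OF cA a(1) _ ij]) auto
      also have "\<dots> \<le> 1" using s1 by simp
      finally show ?thesis by simp
    qed (use b in \<open>auto intro: max.coboundedI1\<close>)
  qed
qed

section \<open>Block sparsity patterns\<close>

text \<open>The number of the block that contains the scalar index \<open>I\<close>. Sparsity is then a condition on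
  pairs of scalar indices, which matrix products and inverses respect without any block arithmetic.
  Blocks of size zero contain no index and are skipped by the minimum.\<close>
definition block_of :: "(nat \<Rightarrow> nat) \<Rightarrow> nat \<Rightarrow> nat" where
  "block_of r I = (LEAST i. I < tot (Suc i) r)"

lemma tot_mono: "i \<le> j \<Longrightarrow> tot i r \<le> tot j r"
  unfolding tot_def by (intro sum_mono2) auto

lemma tot_Suc: "tot (Suc i) r = tot i r + r i"
  by (simp add: tot_def)

lemma block_of_tot: "a < r i \<Longrightarrow> block_of r (tot i r + a) = i"
  unfolding block_of_def
proof (rule Least_equality)
  fix j assume a: "tot i r + a < tot (Suc j) r"
  show "i \<le> j"
  proof (rule ccontr)
    assume "\<not> i \<le> j"
    then have "tot (Suc j) r \<le> tot i r" by (intro tot_mono) auto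
    then show False using a by simp
  qed
qed (simp add: tot_Suc)

lemma tot_add_less: "i < N \<Longrightarrow> a < r i \<Longrightarrow> tot i r + a < tot N r"
  using tot_mono[of "Suc i" N r] by (simp add: tot_Suc)

lemma tot_cases:
  assumes "I < tot N r"
  obtains i a where "i < N" "a < r i" "I = tot i r + a"
proof -
  have "\<exists>i a. i < N \<and> a < r i \<and> I = tot i r + a"
    using assms
  proof (induction N)
    case (Suc N)
    show ?case
    proof (cases "I < tot N r")
      case True
      then show ?thesis using Suc.IH less_SucI by blast
    next
      case False
      then show ?thesis
        using Suc.prems by (intro exI[of _ N] exI[of _ "I - tot N r"]) (auto simp: tot_Suc)
    qed
  qed (simp add: tot_def)
  then show ?thesis using that by blast
qed

text \<open>Here \<open>\<rho> j i\<close> means that input block \<open>j\<close> may act on output block \<open>i\<close>. The relations of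
  interest are equality, for block-diagonal matrices, and reachability in the graph.\<close>
definition pattern ::
    "(nat \<Rightarrow> nat \<Rightarrow> bool) \<Rightarrow> (nat \<Rightarrow> nat) \<Rightarrow> (nat \<Rightarrow> nat) \<Rightarrow> 'a :: zero mat \<Rightarrow> bool" where
  "pattern \<rho> r c M \<longleftrightarrow>
     (\<forall>I<dim_row M. \<forall>J<dim_col M. M $$ (I, J) \<noteq> 0 \<longrightarrow> \<rho> (block_of c J) (block_of r I))"

lemma pattern_entry:
  assumes "pattern \<rho> r c M" "M \<in> carrier_mat (tot N r) (tot N c)"
    and "i < N" "j < N" "a < r i" "b < c j" "\<not> \<rho> j i"
  shows "M $$ (tot i r + a, tot j c + b) = 0"
proof (rule ccontr)
  assume "M $$ (tot i r + a, tot j c + b) \<noteq> 0"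
  then have "\<rho> (block_of c (tot j c + b)) (block_of r (tot i r + a))"
    using assms tot_add_less[of i N a r] tot_add_less[of j N b c] by (auto simp: pattern_def)
  then show False using assms by (simp add: block_of_tot)
qed

lemma pattern_mono: "pattern \<rho> r c M \<Longrightarrow> (\<And>i j. \<rho> i j \<Longrightarrow> \<sigma> i j) \<Longrightarrow> pattern \<sigma> r c M"
  by (auto simp: pattern_def)

lemma pattern_zero: "pattern \<rho> r c (0\<^sub>m m n)"
  by (simp add: pattern_def)

lemma pattern_one: "reflp \<rho> \<Longrightarrow> pattern \<rho> r r (1\<^sub>m n)"
  by (auto simp: pattern_def dest: reflpD)

lemma pattern_add:
  fixes A :: "'a :: monoid_add mat"
  assumes "pattern \<rho> r c A" "pattern \<rho> r c B" and dims: "dim_row A = dim_row B" "dim_col A = dim_col B"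
  shows "pattern \<rho> r c (A + B)"
  unfolding pattern_def
proof (intro allI impI)
  fix I J assume IJ: "I < dim_row (A + B)" "J < dim_col (A + B)" "(A + B) $$ (I, J) \<noteq> 0"
  then have "A $$ (I, J) \<noteq> 0 \<or> B $$ (I, J) \<noteq> 0" by auto
  then show "\<rho> (block_of c J) (block_of r I)" using assms IJ by (auto simp: pattern_def)
qed

lemma pattern_uminus:
  fixes A :: "'a :: group_add mat"
  shows "pattern \<rho> r c A \<Longrightarrow> pattern \<rho> r c (- A)"
  by (auto simp: pattern_def)

lemma pattern_map:
  assumes "pattern \<rho> r c A" "f 0 = 0"
  shows "pattern \<rho> r c (map_mat f A)"
  unfolding pattern_def
proof (intro allI impI)
  fix I J assume IJ: "I < dim_row (map_mat f A)" "J < dim_col (map_mat f A)" "map_mat f A $$ (I, J) \<noteq> 0"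
  then have "A $$ (I, J) \<noteq> 0" using assms(2) by auto
  then show "\<rho> (block_of c J) (block_of r I)" using assms(1) IJ by (auto simp: pattern_def)
qed

lemma pattern_smult:
  fixes A :: "'a :: mult_zero mat"
  shows "pattern \<rho> r c A \<Longrightarrow> pattern \<rho> r c (k \<cdot>\<^sub>m A)"
  unfolding smult_mat_def by (rule pattern_map) auto

lemma pattern_mult:
  fixes A :: "'a :: semiring_0 mat"
  assumes A: "pattern \<rho> r q A" and B: "pattern \<rho> q c B"
    and \<rho>: "transp \<rho>" and dims: "dim_col A = dim_row B"
  shows "pattern \<rho> r c (A * B)"
  unfolding pattern_def
proof (intro allI impI)
  fix I J assume IJ: "I < dim_row (A * B)" "J < dim_col (A * B)" "(A * B) $$ (I, J) \<noteq> 0"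
  have "(A * B) $$ (I, J) = (\<Sum>k\<in>{0..<dim_row B}. A $$ (I, k) * B $$ (k, J))"
    using dims IJ(1,2) by (simp add: scalar_prod_def)
  then have "(\<Sum>k\<in>{0..<dim_row B}. A $$ (I, k) * B $$ (k, J)) \<noteq> 0" using IJ(3) by argo
  then obtain k where "k \<in> {0..<dim_row B}" "A $$ (I, k) * B $$ (k, J) \<noteq> 0"
    by (rule sum.not_neutral_contains_not_neutral)
  then have "k < dim_row B" "A $$ (I, k) \<noteq> 0" "B $$ (k, J) \<noteq> 0"
    using mult_not_zero[of "A $$ (I, k)" "B $$ (k, J)"] by auto
  then have "\<rho> (block_of q k) (block_of r I)" "\<rho> (block_of c J) (block_of q k)"
    using A B IJ dims by (auto simp: pattern_def)
  then show "\<rho> (block_of c J) (block_of r I)" using \<rho> by (meson transpD)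
qed

text \<open>Supports on a preorder are inherited by inverses. Equality is a preorder too, so this also
  covers inverses of block-diagonal matrices.\<close>
lemma pattern_inv_dominant:
  assumes X: "X \<in> carrier_mat n n" "row_sums_le X a" "pattern \<rho> r r X" and a: "a < cmod c"
    and \<rho>: "reflp \<rho>" "transp \<rho>"
  shows "pattern \<rho> r r (inv_mat (c \<cdot>\<^sub>m 1\<^sub>m n - X))"
proof -
  have "inv_mat (c \<cdot>\<^sub>m 1\<^sub>m n - X) \<in> carrier_mat n n"
    using inv_mat_inverse(1)[OF _ det_dominant_nonzero[OF X(1,2) a]] X(1) by (simp add: minus_carrier_mat)
  then show ?thesis
    using X(1,3) inv_dominant_pattern[OF X(1,2) a \<rho>, where f = "block_of r"]
    by (auto simp: pattern_def)
qed

lemma block_diagonal_pattern: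
  assumes "block_diagonal N r c M"
  shows "pattern (=) r c M"
  unfolding pattern_def
proof (intro allI impI)
  have M: "M \<in> carrier_mat (tot N r) (tot N c)" using assms by (simp add: block_diagonal_def)
  fix I J assume IJ: "I < dim_row M" "J < dim_col M" "M $$ (I, J) \<noteq> 0"
  obtain i a where i: "i < N" "a < r i" "I = tot i r + a" using IJ M by (auto elim: tot_cases)
  obtain j b where j: "j < N" "b < c j" "J = tot j c + b" using IJ M by (auto elim: tot_cases)
  have "blk r c M i j $$ (a, b) \<noteq> 0" using IJ i j by (simp add: blk_def)
  moreover have "blk r c M i j $$ (a, b) = 0" if "i \<noteq> j"
    using assms i j that by (simp add: block_diagonal_def)
  ultimately have "i = j" by blast
  then show "block_of c J = block_of r I" using i j by (simp add: block_of_tot)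
qed

section \<open>The algebra of delayed controllers\<close>

lemma L_prop_blk:
  assumes "G \<in> L_prop (tot N r) (tot N c)" "i < N" "j < N"
  shows "(\<lambda>s. blk r c (G s) i j) \<in> L_prop (r i) (c j)"
proof (rule L_prop_entrywise)
  fix a b assume "a < r i" "b < c j"
  then show "\<exists>\<alpha>. bounded_hol \<alpha> (\<lambda>s. blk r c (G s) i j $$ (a, b))"
    using L_prop_entry[OF assms(1) tot_add_less[where r = r] tot_add_less, of i a j b] assms(2,3)
    by (simp add: blk_def)
qed (simp add: blk_def)

lemma rtrancl_iff_reaches: "(j, i) \<in> E\<^sup>* \<longleftrightarrow> i = j \<or> reaches E j i"
  by (auto simp: reaches_def rtrancl_eq_or_trancl)

lemma reflp_rtrancl: "reflp (\<lambda>j i. (j, i) \<in> E\<^sup>*)"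
  by (auto intro: reflpI)

lemma transp_rtrancl: "transp (\<lambda>j i. (j, i) \<in> E\<^sup>*)"
  by (auto intro: transpI)

text \<open>All delayed blocks carry the same factor, so they can be collected in one matrix \<open>Ko\<close>. The
  support of \<open>Ko\<close> is a reflexive relation: \<open>Ko\<close> may have diagonal blocks, although the definition
  of \<open>S_delay\<close> delays only off-diagonal ones, because a delayed proper block is itself proper.
  Allowing this makes the form stable under products and inverses.\<close>
lemma S_delay_iff:
  assumes \<tau>: "\<tau> \<ge> 0"
  shows "K \<in> S_delay N r c E \<tau> \<longleftrightarrow>
    (\<exists>Kd \<in> L_prop (tot N r) (tot N c). \<exists>Ko \<in> L_prop (tot N r) (tot N c).
      \<forall>\<^sub>F s in right_half_planes. pattern (=) r c (Kd s) \<and> pattern (\<lambda>j i. (j, i) \<in> E\<^sup>*) r c (Ko s) \<and>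
        K s = Kd s + exp (- s * complex_of_real \<tau>) \<cdot>\<^sub>m Ko s)"
proof
  assume "K \<in> S_delay N r c E \<tau>"
  then obtain Kb where Kb: "\<And>i j. i < N \<Longrightarrow> j < N \<Longrightarrow> Kb i j \<in> L_prop (r i) (c j)"
    and ev: "\<forall>\<^sub>F s in right_half_planes. K s \<in> carrier_mat (tot N r) (tot N c) \<and>
       (\<forall>i<N. \<forall>j<N. blk r c (K s) i j =
          (if i = j then Kb i i s
           else if reaches E j i then exp (- s * complex_of_real \<tau>) \<cdot>\<^sub>m Kb i j s
           else 0\<^sub>m (r i) (c j)))"
    unfolding S_delay_def by auto
  define entry where "entry I J s =
    Kb (block_of r I) (block_of c J) s $$ (I - tot (block_of r I) r, J - tot (block_of c J) c)" for I J s
  define Kd where "Kd s = Matrix.mat (tot N r) (tot N c)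
    (\<lambda>(I, J). if block_of r I = block_of c J then entry I J s else 0)" for s
  define Ko where "Ko s = Matrix.mat (tot N r) (tot N c)
    (\<lambda>(I, J). if reaches E (block_of c J) (block_of r I) then entry I J s else 0)" for s
  have entry: "\<exists>\<alpha>. bounded_hol \<alpha> (entry I J)" if IJ: "I < tot N r" "J < tot N c" for I J
  proof -
    obtain i a where i: "i < N" "a < r i" "I = tot i r + a" using IJ by (auto elim: tot_cases)
    obtain j b where j: "j < N" "b < c j" "J = tot j c + b" using IJ by (auto elim: tot_cases)
    show ?thesis
      using L_prop_entry[OF Kb[OF i(1) j(1)] i(2) j(2)] i j
      by (auto simp: entry_def[abs_def] block_of_tot)
  qed
  have "Kd \<in> L_prop (tot N r) (tot N c)"
  proof (rule L_prop_entrywise)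
    fix I J assume "I < tot N r" "J < tot N c"
    then show "\<exists>\<alpha>. bounded_hol \<alpha> (\<lambda>s. Kd s $$ (I, J))"
      using entry[of I J] bounded_hol_const
      by (cases "block_of r I = block_of c J") (auto simp: Kd_def)
  qed (simp add: Kd_def)
  moreover have "Ko \<in> L_prop (tot N r) (tot N c)"
  proof (rule L_prop_entrywise)
    fix I J assume "I < tot N r" "J < tot N c"
    then show "\<exists>\<alpha>. bounded_hol \<alpha> (\<lambda>s. Ko s $$ (I, J))"
      using entry[of I J] bounded_hol_const
      by (cases "reaches E (block_of c J) (block_of r I)") (auto simp: Ko_def)
  qed (simp add: Ko_def)
  moreover have "pattern (=) r c (Kd s)" "pattern (\<lambda>j i. (j, i) \<in> E\<^sup>*) r c (Ko s)" for s
    by (auto simp: pattern_def Kd_def Ko_def rtrancl_iff_reaches)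
  moreover have "\<forall>\<^sub>F s in right_half_planes. K s = Kd s + exp (- s * complex_of_real \<tau>) \<cdot>\<^sub>m Ko s"
    using ev
  proof eventually_elim
    case (elim s)
    show ?case
    proof (rule eq_matI)
      fix I J assume "I < dim_row (Kd s + exp (- s * complex_of_real \<tau>) \<cdot>\<^sub>m Ko s)"
        "J < dim_col (Kd s + exp (- s * complex_of_real \<tau>) \<cdot>\<^sub>m Ko s)"
      then have IJ: "I < tot N r" "J < tot N c" by (auto simp: Ko_def)
      obtain i a where i: "i < N" "a < r i" "I = tot i r + a" using IJ by (auto elim: tot_cases)
      obtain j b where j: "j < N" "b < c j" "J = tot j c + b" using IJ by (auto elim: tot_cases)
      have "K s $$ (I, J) = blk r c (K s) i j $$ (a, b)" using i j by (simp add: blk_def)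
      moreover have blk: "blk r c (K s) i j = (if i = j then Kb i i s
           else if reaches E j i then exp (- s * complex_of_real \<tau>) \<cdot>\<^sub>m Kb i j s
           else 0\<^sub>m (r i) (c j))" using elim i(1) j(1) by blast
      moreover have "a < dim_row (blk r c (K s) i j)" "b < dim_col (blk r c (K s) i j)"
        using i j by (auto simp: blk_def)
      moreover have "\<not> reaches E j i" if "i = j" using that by (simp add: reaches_def)
      ultimately show "K s $$ (I, J) = (Kd s + exp (- s * complex_of_real \<tau>) \<cdot>\<^sub>m Ko s) $$ (I, J)"
        using IJ i j by (auto simp: Kd_def Ko_def entry_def block_of_tot split: if_splits)
    qed (use elim in \<open>auto simp: Ko_def\<close>)
  qed
  ultimately show "\<exists>Kd \<in> L_prop (tot N r) (tot N c). \<exists>Ko \<in> L_prop (tot N r) (tot N c).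
      \<forall>\<^sub>F s in right_half_planes. pattern (=) r c (Kd s) \<and> pattern (\<lambda>j i. (j, i) \<in> E\<^sup>*) r c (Ko s) \<and>
        K s = Kd s + exp (- s * complex_of_real \<tau>) \<cdot>\<^sub>m Ko s"
    by (intro bexI[of _ Kd] bexI[of _ Ko]) auto
next
  assume "\<exists>Kd \<in> L_prop (tot N r) (tot N c). \<exists>Ko \<in> L_prop (tot N r) (tot N c).
      \<forall>\<^sub>F s in right_half_planes. pattern (=) r c (Kd s) \<and> pattern (\<lambda>j i. (j, i) \<in> E\<^sup>*) r c (Ko s) \<and>
        K s = Kd s + exp (- s * complex_of_real \<tau>) \<cdot>\<^sub>m Ko s"
  then obtain Kd Ko where Kd: "Kd \<in> L_prop (tot N r) (tot N c)" and Ko: "Ko \<in> L_prop (tot N r) (tot N c)"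
    and ev: "\<forall>\<^sub>F s in right_half_planes. pattern (=) r c (Kd s) \<and> pattern (\<lambda>j i. (j, i) \<in> E\<^sup>*) r c (Ko s) \<and>
        K s = Kd s + exp (- s * complex_of_real \<tau>) \<cdot>\<^sub>m Ko s" by blast
  define Kb where "Kb i j s = (if i = j then
      blk r c (Kd s + exp (- s * complex_of_real \<tau>) \<cdot>\<^sub>m Ko s) i i else blk r c (Ko s) i j)" for i j s
  have "Kb i j \<in> L_prop (r i) (c j)" if "i < N" "j < N" for i j
    using L_prop_blk[OF L_prop_add[OF Kd L_prop_delay[OF \<tau> Ko]] that] L_prop_blk[OF Ko that]
    by (cases "i = j") (simp_all add: Kb_def[abs_def])
  moreover have "\<forall>\<^sub>F s in right_half_planes. K s \<in> carrier_mat (tot N r) (tot N c) \<and>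
       (\<forall>i<N. \<forall>j<N. blk r c (K s) i j =
          (if i = j then Kb i i s
           else if reaches E j i then exp (- s * complex_of_real \<tau>) \<cdot>\<^sub>m Kb i j s
           else 0\<^sub>m (r i) (c j)))"
    using ev L_prop_eventually_carrier[OF Kd] L_prop_eventually_carrier[OF Ko]
  proof eventually_elim
    case (elim s)
    have "blk r c (K s) i j = (if i = j then Kb i i s
           else if reaches E j i then exp (- s * complex_of_real \<tau>) \<cdot>\<^sub>m Kb i j s
           else 0\<^sub>m (r i) (c j))" if ij: "i < N" "j < N" for i j
    proof (cases "i = j")
      case True
      then show ?thesis using elim by (simp add: Kb_def)
    next
      case False
      have entries: "Kd s $$ (tot i r + a, tot j c + b) = 0"
        "\<not> reaches E j i \<Longrightarrow> Ko s $$ (tot i r + a, tot j c + b) = 0"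
        "tot i r + a < tot N r" "tot j c + b < tot N c" if "a < r i" "b < c j" for a b
        using elim False tot_add_less[where r = r, OF ij(1) that(1)] tot_add_less[where r = c, OF ij(2) that(2)]
          pattern_entry[where r = r and c = c and M = "Kd s" and \<rho> = "(=)", OF _ _ ij that]
          pattern_entry[where r = r and c = c and M = "Ko s" and \<rho> = "\<lambda>j i. (j, i) \<in> E\<^sup>*", OF _ _ ij that]
        by (auto simp: rtrancl_iff_reaches)
      show ?thesis
        using False entries elim by (intro eq_matI) (auto simp: Kb_def blk_def)
    qed
    then show ?case using elim by auto
  qed
  ultimately show "K \<in> S_delay N r c E \<tau>"
    unfolding S_delay_def by blast
qed

lemma S_delay_cong:
  assumes "G \<in> S_delay N r c E \<tau>" "\<forall>\<^sub>F s in right_half_planes. H s = G s"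
  shows "H \<in> S_delay N r c E \<tau>"
proof -
  obtain Kb where Kb: "\<forall>i<N. \<forall>j<N. Kb i j \<in> L_prop (r i) (c j)"
    and ev: "\<forall>\<^sub>F s in right_half_planes. G s \<in> carrier_mat (tot N r) (tot N c) \<and>
       (\<forall>i<N. \<forall>j<N. blk r c (G s) i j =
          (if i = j then Kb i i s
           else if reaches E j i then exp (- s * complex_of_real \<tau>) \<cdot>\<^sub>m Kb i j s
           else 0\<^sub>m (r i) (c j)))"
    using assms(1) unfolding S_delay_def by auto
  have "\<forall>\<^sub>F s in right_half_planes. H s \<in> carrier_mat (tot N r) (tot N c) \<and>
       (\<forall>i<N. \<forall>j<N. blk r c (H s) i j =
          (if i = j then Kb i i s
           else if reaches E j i then exp (- s * complex_of_real \<tau>) \<cdot>\<^sub>m Kb i j s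
           else 0\<^sub>m (r i) (c j)))"
    using ev assms(2) by eventually_elim (erule ssubst, assumption)
  then show ?thesis using Kb unfolding S_delay_def by blast
qed

lemma S_delay_imp_L_prop:
  assumes \<tau>: "\<tau> \<ge> 0" and K: "K \<in> S_delay N r c E \<tau>"
  shows "K \<in> L_prop (tot N r) (tot N c)"
proof -
  obtain Kd Ko where K: "Kd \<in> L_prop (tot N r) (tot N c)" "Ko \<in> L_prop (tot N r) (tot N c)"
    and ev: "\<forall>\<^sub>F s in right_half_planes. pattern (=) r c (Kd s) \<and> pattern (\<lambda>j i. (j, i) \<in> E\<^sup>*) r c (Ko s) \<and>
        K s = Kd s + exp (- s * complex_of_real \<tau>) \<cdot>\<^sub>m Ko s"
    using K unfolding S_delay_iff[OF \<tau>] by blast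
  show ?thesis
    by (rule L_prop_cong[OF L_prop_add[OF K(1) L_prop_delay[OF \<tau> K(2)]]])
       (use ev in eventually_elim, simp)
qed

lemma S_delay_block_diagonal:
  assumes \<tau>: "\<tau> \<ge> 0" and G: "G \<in> L_prop (tot N r) (tot N c)"
    and p: "\<forall>\<^sub>F s in right_half_planes. pattern (=) r c (G s)"
  shows "G \<in> S_delay N r c E \<tau>"
  unfolding S_delay_iff[OF \<tau>]
proof (intro bexI)
  show "(\<lambda>s. 0\<^sub>m (tot N r) (tot N c)) \<in> L_prop (tot N r) (tot N c)"
    by (rule L_prop_const) simp
  show "\<forall>\<^sub>F s in right_half_planes. pattern (=) r c (G s) \<and>
    pattern (\<lambda>j i. (j, i) \<in> E\<^sup>*) r c (0\<^sub>m (tot N r) (tot N c) :: complex mat) \<and>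
    G s = G s + exp (- s * complex_of_real \<tau>) \<cdot>\<^sub>m 0\<^sub>m (tot N r) (tot N c)"
    using p L_prop_eventually_carrier[OF G] by eventually_elim (auto simp: pattern_zero)
qed (rule G)

lemma S_delay_add:
  assumes \<tau>: "\<tau> \<ge> 0" and K: "K \<in> S_delay N r c E \<tau>" and H: "H \<in> S_delay N r c E \<tau>"
  shows "(\<lambda>s. K s + H s) \<in> S_delay N r c E \<tau>"
proof -
  obtain Kd Ko where K: "Kd \<in> L_prop (tot N r) (tot N c)" "Ko \<in> L_prop (tot N r) (tot N c)"
    and evK: "\<forall>\<^sub>F s in right_half_planes. pattern (=) r c (Kd s) \<and> pattern (\<lambda>j i. (j, i) \<in> E\<^sup>*) r c (Ko s) \<and>
        K s = Kd s + exp (- s * complex_of_real \<tau>) \<cdot>\<^sub>m Ko s"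
    using K unfolding S_delay_iff[OF \<tau>] by blast
  obtain Hd Ho where H: "Hd \<in> L_prop (tot N r) (tot N c)" "Ho \<in> L_prop (tot N r) (tot N c)"
    and evH: "\<forall>\<^sub>F s in right_half_planes. pattern (=) r c (Hd s) \<and> pattern (\<lambda>j i. (j, i) \<in> E\<^sup>*) r c (Ho s) \<and>
        H s = Hd s + exp (- s * complex_of_real \<tau>) \<cdot>\<^sub>m Ho s"
    using H unfolding S_delay_iff[OF \<tau>] by blast
  note car = K[THEN L_prop_eventually_carrier] H[THEN L_prop_eventually_carrier]
  show ?thesis
    unfolding S_delay_iff[OF \<tau>]
  proof (intro bexI)
    show "\<forall>\<^sub>F s in right_half_planes. pattern (=) r c (Kd s + Hd s) \<and>
      pattern (\<lambda>j i. (j, i) \<in> E\<^sup>*) r c (Ko s + Ho s) \<and>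
      K s + H s = (Kd s + Hd s) + exp (- s * complex_of_real \<tau>) \<cdot>\<^sub>m (Ko s + Ho s)"
      using evK evH car
      by eventually_elim (auto intro: pattern_add intro!: eq_matI simp: algebra_simps)
  qed (use K H in \<open>auto intro: L_prop_add\<close>)
qed

text \<open>With \<open>\<delta> = e\<^sup>-\<^sup>s\<^sup>\<tau>\<close>, one has
  \<open>(K\<^sub>d + \<delta> K\<^sub>o) (H\<^sub>d + \<delta> H\<^sub>o) = K\<^sub>d H\<^sub>d + \<delta> (K\<^sub>d H\<^sub>o + K\<^sub>o H\<^sub>d + \<delta> K\<^sub>o H\<^sub>o)\<close>.
  The bracket is proper since \<open>\<delta>\<close> is bounded for \<open>\<tau> \<ge> 0\<close>.\<close>
lemma S_delay_mult:
  assumes \<tau>: "\<tau> \<ge> 0" and K: "K \<in> S_delay N r q E \<tau>" and H: "H \<in> S_delay N q c E \<tau>"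
  shows "(\<lambda>s. K s * H s) \<in> S_delay N r c E \<tau>"
proof -
  let ?\<delta> = "\<lambda>s. exp (- s * complex_of_real \<tau>)"
  obtain Kd Ko where K: "Kd \<in> L_prop (tot N r) (tot N q)" "Ko \<in> L_prop (tot N r) (tot N q)"
    and evK: "\<forall>\<^sub>F s in right_half_planes. pattern (=) r q (Kd s) \<and> pattern (\<lambda>j i. (j, i) \<in> E\<^sup>*) r q (Ko s) \<and>
        K s = Kd s + ?\<delta> s \<cdot>\<^sub>m Ko s"
    using K unfolding S_delay_iff[OF \<tau>] by blast
  obtain Hd Ho where H: "Hd \<in> L_prop (tot N q) (tot N c)" "Ho \<in> L_prop (tot N q) (tot N c)"
    and evH: "\<forall>\<^sub>F s in right_half_planes. pattern (=) q c (Hd s) \<and> pattern (\<lambda>j i. (j, i) \<in> E\<^sup>*) q c (Ho s) \<and>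
        H s = Hd s + ?\<delta> s \<cdot>\<^sub>m Ho s"
    using H unfolding S_delay_iff[OF \<tau>] by blast
  note car = K[THEN L_prop_eventually_carrier] H[THEN L_prop_eventually_carrier]
  show ?thesis
    unfolding S_delay_iff[OF \<tau>]
  proof (intro bexI)
    show "\<forall>\<^sub>F s in right_half_planes. pattern (=) r c (Kd s * Hd s) \<and>
      pattern (\<lambda>j i. (j, i) \<in> E\<^sup>*) r c (Kd s * Ho s + (Ko s * Hd s + ?\<delta> s \<cdot>\<^sub>m (Ko s * Ho s))) \<and>
      K s * H s = Kd s * Hd s + ?\<delta> s \<cdot>\<^sub>m (Kd s * Ho s + (Ko s * Hd s + ?\<delta> s \<cdot>\<^sub>m (Ko s * Ho s)))"
      using evK evH car
    proof eventually_elim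
      case (elim s)
      note [simp] = elim(3-6) elim(3-6)[THEN carrier_matD(1)] elim(3-6)[THEN carrier_matD(2)]
      have p: "pattern (\<lambda>j i. (j, i) \<in> E\<^sup>*) r q (Kd s)" "pattern (\<lambda>j i. (j, i) \<in> E\<^sup>*) q c (Hd s)"
        using elim by (auto intro: pattern_mono)
      have 1: "pattern (=) r c (Kd s * Hd s)"
        using elim by (intro pattern_mult[where q = q]) auto
      have 2: "pattern (\<lambda>j i. (j, i) \<in> E\<^sup>*) r c (Kd s * Ho s + (Ko s * Hd s + ?\<delta> s \<cdot>\<^sub>m (Ko s * Ho s)))"
        using elim p transp_rtrancl
        by (intro pattern_add pattern_smult
            pattern_mult[where q = q]) auto
      have "K s * H s = (Kd s + ?\<delta> s \<cdot>\<^sub>m Ko s) * (Hd s + ?\<delta> s \<cdot>\<^sub>m Ho s)" using elim by simp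
      also have "\<dots> = (Kd s * Hd s + ?\<delta> s \<cdot>\<^sub>m (Kd s * Ho s)) + (?\<delta> s \<cdot>\<^sub>m (Ko s * Hd s) + ?\<delta> s \<cdot>\<^sub>m (?\<delta> s \<cdot>\<^sub>m (Ko s * Ho s)))"
        by (intro eq_matI) (simp_all add: mat_expand algebra_simps del: index_mult_mat(1))
      also have "\<dots> = Kd s * Hd s + ?\<delta> s \<cdot>\<^sub>m (Kd s * Ho s + (Ko s * Hd s + ?\<delta> s \<cdot>\<^sub>m (Ko s * Ho s)))"
        by (intro eq_matI) (auto simp: algebra_simps simp del: index_mult_mat(1))
      finally show ?case using 1 2 by blast
    qed
  qed (intro L_prop_add L_prop_delay[OF \<tau>] L_prop_mult[where n = "tot N q"] K H)+
qed

text \<open>Write \<open>X = Y K = X\<^sub>d + \<delta> X\<^sub>o\<close>, \<open>R = (1 - X)\<^sup>-\<^sup>1\<close> and \<open>R\<^sub>d = (1 - X\<^sub>d)\<^sup>-\<^sup>1\<close>. Expanding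
  \<open>R\<^sub>d (1 - X) R\<close> in two ways gives \<open>R = R\<^sub>d + \<delta> R\<^sub>d X\<^sub>o R\<close>. The factor \<open>Y\<close> makes \<open>X\<close> and
  \<open>X\<^sub>d\<close> strictly proper, which yields properness and support of \<open>R\<close> and \<open>R\<^sub>d\<close>.\<close>
lemma S_delay_inverse:
  assumes \<tau>: "\<tau> \<ge> 0" and Y: "vanishing (tot N r) (tot N q) Y"
    and pY: "\<forall>\<^sub>F s in right_half_planes. pattern (=) r q (Y s)" and K: "K \<in> S_delay N q r E \<tau>"
  shows "(\<lambda>s. inv_mat (1\<^sub>m (tot N r) - Y s * K s)) \<in> S_delay N r r E \<tau>"
proof -
  let ?\<delta> = "\<lambda>s. exp (- s * complex_of_real \<tau>)"
  let ?n = "tot N r" and ?m = "tot N q"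
  have Kprop: "K \<in> L_prop ?m ?n" using S_delay_imp_L_prop[OF \<tau> K] .
  obtain Kd Ko where K: "Kd \<in> L_prop ?m ?n" "Ko \<in> L_prop ?m ?n"
    and evK: "\<forall>\<^sub>F s in right_half_planes. pattern (=) q r (Kd s) \<and> pattern (\<lambda>j i. (j, i) \<in> E\<^sup>*) q r (Ko s) \<and>
        K s = Kd s + ?\<delta> s \<cdot>\<^sub>m Ko s"
    using K unfolding S_delay_iff[OF \<tau>] by blast
  define X where "X s = Y s * K s" for s
  define Xd where "Xd s = Y s * Kd s" for s
  define Xo where "Xo s = Y s * Ko s" for s
  define R where "R s = inv_mat (1\<^sub>m ?n - X s)" for s
  define Rd where "Rd s = inv_mat (1\<^sub>m ?n - Xd s)" for s
  have van: "vanishing ?n ?n X" "vanishing ?n ?n Xd" "vanishing ?n ?n Xo"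
    unfolding X_def[abs_def] Xd_def[abs_def] Xo_def[abs_def]
    using vanishing_mult_right[OF Y] Kprop K by auto
  have R: "R \<in> L_prop ?n ?n" and Rd: "Rd \<in> L_prop ?n ?n"
    unfolding R_def[abs_def] Rd_def[abs_def] using van vanishing_inverse by auto
  have "R \<in> S_delay N r r E \<tau>"
    unfolding S_delay_iff[OF \<tau>]
  proof (intro bexI)
    show "(\<lambda>s. Rd s * (Xo s * R s)) \<in> L_prop ?n ?n"
      using R Rd van by (auto intro!: L_prop_mult simp: vanishing_def)
    have half: "0 < (1/2 :: real)" by simp
    have Yprop: "Y \<in> L_prop ?n ?m" using Y by (simp add: vanishing_def)
    show "\<forall>\<^sub>F s in right_half_planes. pattern (=) r r (Rd s) \<and>
      pattern (\<lambda>j i. (j, i) \<in> E\<^sup>*) r r (Rd s * (Xo s * R s)) \<and>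
      R s = Rd s + ?\<delta> s \<cdot>\<^sub>m (Rd s * (Xo s * R s))"
      using evK pY K[THEN L_prop_eventually_carrier] L_prop_eventually_carrier[OF Yprop]
        vanishing_row_sums[OF van(1) half] vanishing_row_sums[OF van(2) half]
    proof eventually_elim
      case (elim s)
      note [simp] = elim(3-5) elim(3-5)[THEN carrier_matD(1)] elim(3-5)[THEN carrier_matD(2)]
      have X: "X s \<in> carrier_mat ?n ?n" "row_sums_le (X s) (1/2)"
        and Xd: "Xd s \<in> carrier_mat ?n ?n" "row_sums_le (Xd s) (1/2)"
        and Xo: "Xo s \<in> carrier_mat ?n ?n"
        using elim(6,7) mult_carrier_mat[OF elim(5,4)] by (auto simp: Xo_def)
      have less: "1/2 < cmod 1" by simp
      have dX: "det (1\<^sub>m ?n - X s) \<noteq> 0" and dXd: "det (1\<^sub>m ?n - Xd s) \<noteq> 0"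
        using det_dominant_nonzero[OF X less] det_dominant_nonzero[OF Xd less] by (auto simp: one_smult_mat)
      have cars: "1\<^sub>m ?n - X s \<in> carrier_mat ?n ?n" "1\<^sub>m ?n - Xd s \<in> carrier_mat ?n ?n"
        using X Xd by (auto intro: minus_carrier_mat)
      note R = inv_mat_inverse[OF cars(1) dX, folded R_def]
      note Rd = inv_mat_inverse[OF cars(2) dXd, folded Rd_def]
      have pd: "pattern (\<lambda>j i. (j, i) \<in> E\<^sup>*) q r (Kd s)" "pattern (\<lambda>j i. (j, i) \<in> E\<^sup>*) r q (Y s)"
        using elim by (auto intro: pattern_mono)
      have pXd: "pattern (=) r r (Xd s)"
        unfolding Xd_def using elim by (intro pattern_mult[where q = q]) auto
      have pXo: "pattern (\<lambda>j i. (j, i) \<in> E\<^sup>*) r r (Xo s)"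
        unfolding Xo_def using elim pd transp_rtrancl
        by (intro pattern_mult[where q = q]) auto
      have Xeq: "X s = Xd s + ?\<delta> s \<cdot>\<^sub>m Xo s"
        using elim unfolding X_def Xd_def Xo_def
        by (simp add: mat_expand)
      have pX: "pattern (\<lambda>j i. (j, i) \<in> E\<^sup>*) r r (X s)"
        unfolding Xeq using Xd Xo pXd pXo
        by (intro pattern_add pattern_smult) (auto intro: pattern_mono)
      have pR: "pattern (\<lambda>j i. (j, i) \<in> E\<^sup>*) r r (R s)"
        using pattern_inv_dominant[OF X pX less reflp_rtrancl transp_rtrancl]
        by (simp add: R_def one_smult_mat)
      have pRd: "pattern (=) r r (Rd s)"
        using pattern_inv_dominant[OF Xd pXd less] by (simp add: Rd_def one_smult_mat)
      then have pRd': "pattern (\<lambda>j i. (j, i) \<in> E\<^sup>*) r r (Rd s)" by (auto intro: pattern_mono)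
      have 2: "pattern (\<lambda>j i. (j, i) \<in> E\<^sup>*) r r (Rd s * (Xo s * R s))"
        using pRd' pXo pR Rd(1) R(1) Xo transp_rtrancl
        by (intro pattern_mult[where q = r]) auto
      note [simp] = carrier_matD[OF Xo] carrier_matD[OF R(1)] carrier_matD[OF Rd(1)]
        carrier_matD[OF Xd(1)]
      have "1\<^sub>m ?n - X s = (1\<^sub>m ?n - Xd s) - ?\<delta> s \<cdot>\<^sub>m Xo s"
        unfolding Xeq using Xd Xo by (intro eq_matI) auto
      then have "Rd s * (1\<^sub>m ?n - X s) = 1\<^sub>m ?n - ?\<delta> s \<cdot>\<^sub>m (Rd s * Xo s)"
        using Rd by (simp add: mat_distribs mat_mult_smult)
      then have "Rd s * (1\<^sub>m ?n - X s) * R s = R s - ?\<delta> s \<cdot>\<^sub>m (Rd s * (Xo s * R s))"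
        by (simp add: mat_expand)
      moreover have "Rd s * (1\<^sub>m ?n - X s) * R s = Rd s"
        using Rd(1) R(1,2) cars by simp
      ultimately have e: "R s - ?\<delta> s \<cdot>\<^sub>m (Rd s * (Xo s * R s)) = Rd s" by simp
      have "R s = (R s - ?\<delta> s \<cdot>\<^sub>m (Rd s * (Xo s * R s))) + ?\<delta> s \<cdot>\<^sub>m (Rd s * (Xo s * R s))"
        using Rd(1) R(1) Xo by (intro eq_matI) auto
      then show ?case using pRd 2 unfolding e by blast
    qed
  qed (rule Rd)
  then show ?thesis unfolding R_def[abs_def] X_def .
qed


section \<open>State-space realizations\<close>

lemma vanishing_realization:
  assumes "A \<in> carrier_mat n n" "B \<in> carrier_mat n m" "C \<in> carrier_mat p n"
  shows "vanishing p m (realization A B C (0\<^sub>m p m))"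
proof -
  have v: "vanishing n n (\<lambda>s. inv_mat (s \<cdot>\<^sub>m 1\<^sub>m n - cmat A))"
    using assms by (intro vanishing_resolvent) simp
  have "vanishing p m (\<lambda>s. cmat C * inv_mat (s \<cdot>\<^sub>m 1\<^sub>m n - cmat A) * cmat B)"
    using assms by (intro vanishing_mult_right[where n = n] vanishing_mult_left[where n = n] v L_prop_const) auto
  moreover have "realization A B C (0\<^sub>m p m) = (\<lambda>s. cmat C * inv_mat (s \<cdot>\<^sub>m 1\<^sub>m n - cmat A) * cmat B)"
    using assms by (intro ext eq_matI) (auto simp: realization_def simp del: index_mult_mat(1))
  ultimately show ?thesis by simp
qed

lemma L_prop_realization:
  assumes "A \<in> carrier_mat n n" "B \<in> carrier_mat n m" "C \<in> carrier_mat p n" "D \<in> carrier_mat p m"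
  shows "realization A B C D \<in> L_prop p m"
proof -
  have v: "(\<lambda>s. inv_mat (s \<cdot>\<^sub>m 1\<^sub>m n - cmat A)) \<in> L_prop n n"
    using vanishing_resolvent[of "cmat A" n] assms(1) by (simp add: vanishing_def)
  have "(\<lambda>s. cmat D + cmat C * inv_mat (s \<cdot>\<^sub>m 1\<^sub>m n - cmat A) * cmat B) \<in> L_prop p m"
    using assms by (intro L_prop_add L_prop_mult[where n = n] v L_prop_const) auto
  then show ?thesis using assms by (simp add: realization_def[abs_def])
qed

lemma pattern_realization:
  assumes A: "A \<in> carrier_mat n n" and B: "B \<in> carrier_mat n m" and C: "C \<in> carrier_mat p n"
    and D: "D \<in> carrier_mat p m"
    and pat: "pattern (=) q q A" "pattern (=) q c B" "pattern (=) r q C" "pattern (=) r c D"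
  shows "\<forall>\<^sub>F s in right_half_planes. pattern (=) r c (realization A B C D s)"
proof -
  have cA: "cmat A \<in> carrier_mat n n" using A by simp
  obtain a where a: "row_sums_le (cmat A) a" using row_sums_le_exists by blast
  show ?thesis
    using eventually_Re_gt[of a] eventually_resolvent[OF cA]
  proof eventually_elim
    case (elim s)
    have s: "a < cmod s" using elim(1) complex_Re_le_cmod[of s] by linarith
    have R: "inv_mat (s \<cdot>\<^sub>m 1\<^sub>m n - cmat A) \<in> carrier_mat n n"
      using elim(2) cA by (intro inv_mat_inverse(1)) (auto intro: minus_carrier_mat)
    have "pattern (=) q q (inv_mat (s \<cdot>\<^sub>m 1\<^sub>m n - cmat A))"
      using pattern_inv_dominant[OF cA a pattern_map[OF pat(1)] s] by auto
    then show ?case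
      using carrier_matD[OF R] carrier_matD[OF A] carrier_matD[OF B] carrier_matD[OF C] carrier_matD[OF D]
      unfolding realization_def
      by (auto intro!: pattern_add pattern_mult[where q = q] pattern_map pat)
  qed
qed

lemma S_delay_realization:
  assumes "\<tau> \<ge> 0"
    and "A \<in> carrier_mat (tot N q) (tot N q)" "B \<in> carrier_mat (tot N q) (tot N c)"
    and "C \<in> carrier_mat (tot N r) (tot N q)" "D \<in> carrier_mat (tot N r) (tot N c)"
    and "pattern (=) q q A" "pattern (=) q c B" "pattern (=) r q C" "pattern (=) r c D"
  shows "realization A B C D \<in> S_delay N r c E \<tau>"
  using assms by (intro S_delay_block_diagonal L_prop_realization pattern_realization)

section \<open>The parametrization at a fixed frequency\<close>
text \<open>At a fixed frequency \<open>s\<close>, signals are represented by matrices: each column is one signal. The state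
  equation \<open>x' = A x + w\<close> becomes \<open>s X = A X + W\<close>.\<close>
lemma resolvent_eq_iff:
  assumes A: "A \<in> carrier_mat n n" and d: "det (s \<cdot>\<^sub>m 1\<^sub>m n - A) \<noteq> 0"
    and X: "X \<in> carrier_mat n q" and W: "W \<in> carrier_mat n q"
  shows "s \<cdot>\<^sub>m X = A * X + W \<longleftrightarrow> X = inv_mat (s \<cdot>\<^sub>m 1\<^sub>m n - A) * W"
proof -
  let ?M = "s \<cdot>\<^sub>m 1\<^sub>m n - A"
  have M: "?M \<in> carrier_mat n n" using A by (auto intro: minus_carrier_mat)
  note R = inv_mat_inverse[OF M d]
  have MX: "?M * X = s \<cdot>\<^sub>m X - A * X" 
    using A X by (simp add: minus_mult_distrib_mat[of _ n n] mult_smult_assoc_mat[of _ n n])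
  show ?thesis
  proof
    assume "s \<cdot>\<^sub>m X = A * X + W"
    then have "?M * X = W" unfolding MX using A X W by (intro eq_matI) auto
    then have "inv_mat ?M * W = inv_mat ?M * ?M * X" using R(1) M X by (simp del: R)
    then show "X = inv_mat ?M * W" using R X by simp
  next
    assume "X = inv_mat ?M * W"
    then have "?M * X = ?M * inv_mat ?M * W" using R(1) M W by simp
    then have "s \<cdot>\<^sub>m X - A * X = W" using R(2) W MX by simp
    then have "A * X + (s \<cdot>\<^sub>m X - A * X) = A * X + W" by simp
    moreover have "A * X + (s \<cdot>\<^sub>m X - A * X) = s \<cdot>\<^sub>m X" using A X by (intro eq_matI) auto
    ultimately show "s \<cdot>\<^sub>m X = A * X + W" by simp
  qed
qed

text \<open>The transfer matrix from \<open>y\<close> to \<open>u\<close> of the loop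
  \<open>\<xi>' = A \<xi> + B1 y + B2 v\<close>, \<open>u = C1 \<xi> + v\<close>, \<open>e = C2 \<xi> + y\<close>, \<open>v = Q e\<close>. Both \<open>youla_J\<close> and the
  coefficient of the inverse transformation have this shape, with identity feedthrough from \<open>v\<close> to \<open>u\<close> and
  from \<open>y\<close> to \<open>e\<close>.\<close>
definition state_space_lft :: "complex mat \<Rightarrow> complex mat \<Rightarrow> complex mat \<Rightarrow> complex mat \<Rightarrow> complex mat \<Rightarrow>
    complex \<Rightarrow> complex mat \<Rightarrow> complex mat" where
  "state_space_lft A B1 B2 C1 C2 s Q =
     (let \<Phi> = inv_mat (s \<cdot>\<^sub>m 1\<^sub>m (dim_row A) - A) in
      C1 * \<Phi> * B1 + (1\<^sub>m (dim_row C1) + C1 * \<Phi> * B2) * Q *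
        inv_mat (1\<^sub>m (dim_row C2) - C2 * \<Phi> * B2 * Q) * (1\<^sub>m (dim_row C2) + C2 * \<Phi> * B1))"

lemma state_space_lft_carrier:
  assumes "B1 \<in> carrier_mat n p" "C1 \<in> carrier_mat m n"
  shows "dim_row (state_space_lft A B1 B2 C1 C2 s Q) = m" "dim_col (state_space_lft A B1 B2 C1 C2 s Q) = p"
  using assms by (simp_all add: state_space_lft_def Let_def)

text \<open>Eliminating \<open>\<xi>\<close> from the loop equations gives \<open>(1 - C2 \<Phi> B2 Q) e = (1 + C2 \<Phi> B1) y\<close>, where
  \<open>\<Phi>\<close> is the resolvent. The invertibility of the left factor, which is the well-posedness of the
  loop, determines \<open>e\<close> and with it \<open>u\<close>.\<close>
lemma state_space_lft_signals:
  assumes A: "A \<in> carrier_mat n n" and B1: "B1 \<in> carrier_mat n p" and B2: "B2 \<in> carrier_mat n m"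
    and C1: "C1 \<in> carrier_mat m n" and C2: "C2 \<in> carrier_mat p n" and Q: "Q \<in> carrier_mat m p"
    and dA: "det (s \<cdot>\<^sub>m 1\<^sub>m n - A) \<noteq> 0"
    and dQ: "det (1\<^sub>m p - C2 * inv_mat (s \<cdot>\<^sub>m 1\<^sub>m n - A) * B2 * Q) \<noteq> 0"
    and \<xi>: "\<xi> \<in> carrier_mat n q" and y: "y \<in> carrier_mat p q" and v: "v \<in> carrier_mat m q"
    and state: "s \<cdot>\<^sub>m \<xi> = A * \<xi> + (B1 * y + B2 * v)" and loop: "v = Q * (C2 * \<xi> + y)"
  shows "C1 * \<xi> + v = state_space_lft A B1 B2 C1 C2 s Q * y"
proof -
  define \<Phi> where "\<Phi> = inv_mat (s \<cdot>\<^sub>m 1\<^sub>m n - A)"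
  define S where "S = inv_mat (1\<^sub>m p - C2 * \<Phi> * B2 * Q)"
  define e where "e = C2 * \<xi> + y"
  have \<Phi>: "\<Phi> \<in> carrier_mat n n"
    unfolding \<Phi>_def using A dA by (intro inv_mat_inverse(1)) (auto intro: minus_carrier_mat)
  have M: "1\<^sub>m p - C2 * \<Phi> * B2 * Q \<in> carrier_mat p p"
    using C2 \<Phi> B2 Q by (auto intro!: minus_carrier_mat)
  note S = inv_mat_inverse[OF M dQ[folded \<Phi>_def], folded S_def]
  have e: "e \<in> carrier_mat p q" using C2 \<xi> y by (auto simp: e_def)
  note dims [simp] = carrier_matD[OF A] carrier_matD[OF B1] carrier_matD[OF B2] carrier_matD[OF C1]
    carrier_matD[OF C2] carrier_matD[OF Q] carrier_matD[OF \<xi>] carrier_matD[OF y] carrier_matD[OF v]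
    carrier_matD[OF \<Phi>] carrier_matD[OF S(1)] carrier_matD[OF e]
  have \<xi>_eq: "\<xi> = \<Phi> * (B1 * y + B2 * v)"
    using state resolvent_eq_iff[OF A dA \<xi>, of "B1 * y + B2 * v"] B1 B2 y v by (auto simp: \<Phi>_def)
  have v_eq: "v = Q * e" using loop by (simp add: e_def)
  have "e = C2 * (\<Phi> * (B1 * y + B2 * (Q * e))) + y"
    by (subst e_def) (simp add: \<xi>_eq flip: v_eq)
  then have e_sum: "e = C2 * (\<Phi> * (B1 * y)) + C2 * (\<Phi> * (B2 * (Q * e))) + y"
    by (simp add: mat_expand)
  have "e - C2 * (\<Phi> * (B2 * (Q * e))) = y + C2 * (\<Phi> * (B1 * y))"
  proof (rule eq_matI)
    fix i j assume "i < dim_row (y + C2 * (\<Phi> * (B1 * y)))" "j < dim_col (y + C2 * (\<Phi> * (B1 * y)))"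
    then show "(e - C2 * (\<Phi> * (B2 * (Q * e)))) $$ (i, j) = (y + C2 * (\<Phi> * (B1 * y))) $$ (i, j)"
      using arg_cong[OF e_sum, of "\<lambda>M. M $$ (i, j)"] by (simp del: index_mult_mat(1))
  qed simp_all
  then have "(1\<^sub>m p - C2 * \<Phi> * B2 * Q) * e = (1\<^sub>m p + C2 * \<Phi> * B1) * y"
    by (simp add: mat_expand)
  then have "S * ((1\<^sub>m p - C2 * \<Phi> * B2 * Q) * e) = S * ((1\<^sub>m p + C2 * \<Phi> * B1) * y)" by simp
  moreover have "S * ((1\<^sub>m p - C2 * \<Phi> * B2 * Q) * e) = e"
    using S(3) e by (subst assoc_mult_mat[symmetric, OF S(1) M e]) simp
  ultimately have e_eq: "e = S * ((1\<^sub>m p + C2 * \<Phi> * B1) * y)" by simp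
  have lft_eq: "state_space_lft A B1 B2 C1 C2 s Q =
    C1 * \<Phi> * B1 + (1\<^sub>m m + C1 * \<Phi> * B2) * Q * S * (1\<^sub>m p + C2 * \<Phi> * B1)"
    by (simp only: state_space_lft_def Let_def S_def \<Phi>_def dims)
  have "C1 * \<xi> + v = C1 * (\<Phi> * (B1 * y)) + (v + C1 * (\<Phi> * (B2 * v)))"
    by (rule eq_matI) (simp_all add: \<xi>_eq mat_expand del: index_mult_mat(1))
  also have "\<dots> = state_space_lft A B1 B2 C1 C2 s Q * y"
    unfolding lft_eq by (intro eq_matI) (simp_all add: v_eq e_eq mat_expand del: index_mult_mat(1))
  finally show ?thesis .
qed


lemma det_one_minus_dominant_nonzero:
  assumes "X \<in> carrier_mat n n" "row_sums_le X (1/2)"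
  shows "det (1\<^sub>m n - X) \<noteq> 0"
  using det_dominant_nonzero[OF assms, of 1] by (simp add: one_smult_mat)

text \<open>The transformations \<open>K \<mapsto> Q\<close> and \<open>Q \<mapsto> K\<close> are mutually inverse because they describe the
  same signals: reading \<open>y = C \<xi> + e\<close> and \<open>u = F \<xi> + v\<close> as definitions of \<open>e\<close> and \<open>v\<close> turns the
  state equation of one loop into that of the other.\<close>
lemma controller_of_parameter:
  assumes A: "A \<in> carrier_mat n n" and B: "B \<in> carrier_mat n m" and C: "C \<in> carrier_mat p n"
    and F: "F \<in> carrier_mat m n" and L: "L \<in> carrier_mat n p" and K: "K \<in> carrier_mat m p"
    and dA: "det (s \<cdot>\<^sub>m 1\<^sub>m n - A) \<noteq> 0"
    and dAL: "det (s \<cdot>\<^sub>m 1\<^sub>m n - (A + L * C)) \<noteq> 0"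
    and dAk: "det (s \<cdot>\<^sub>m 1\<^sub>m n - (A + B * F + L * C)) \<noteq> 0"
    and dK: "det (1\<^sub>m p - C * inv_mat (s \<cdot>\<^sub>m 1\<^sub>m n - A) * B * K) \<noteq> 0"
    and Q: "Q = state_space_lft A (- L) B (- F) C s K"
    and dQ: "det (1\<^sub>m p - (- C) * inv_mat (s \<cdot>\<^sub>m 1\<^sub>m n - (A + B * F + L * C)) * B * Q) \<noteq> 0"
  shows "K = state_space_lft (A + B * F + L * C) (- L) B F (- C) s Q"
proof -
  \<comment> \<open>The input \<open>y\<close> is the identity matrix, so \<open>u = K\<close>. With \<open>e\<close> and \<open>v\<close> eliminated, the state equation
    of either loop is driven by \<open>A + L * C\<close>, which defines \<open>\<xi>\<close>.\<close>
  define \<xi> where "\<xi> = inv_mat (s \<cdot>\<^sub>m 1\<^sub>m n - (A + L * C)) * (B * K - L)"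
  define e where "e = 1\<^sub>m p - C * \<xi>"
  define v where "v = K - F * \<xi>"
  have AL: "A + L * C \<in> carrier_mat n n" and Ak: "A + B * F + L * C \<in> carrier_mat n n"
    using A B C F L by auto
  have R: "inv_mat (s \<cdot>\<^sub>m 1\<^sub>m n - (A + L * C)) \<in> carrier_mat n n"
    using AL dAL by (intro inv_mat_inverse(1)) (auto intro: minus_carrier_mat)
  have BKL: "B * K - L \<in> carrier_mat n p" using L by (auto intro: minus_carrier_mat)
  have \<xi>: "\<xi> \<in> carrier_mat n p" using R BKL by (auto simp: \<xi>_def)
  have e: "e \<in> carrier_mat p p" and v: "v \<in> carrier_mat m p"
    using C F \<xi> K by (auto simp: e_def v_def intro!: minus_carrier_mat)
  have Qc: "Q \<in> carrier_mat m p"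
    using state_space_lft_carrier[of "- L" n p "- F" m] L F by (auto simp: Q)
  note dims [simp] = carrier_matD[OF A] carrier_matD[OF B] carrier_matD[OF C] carrier_matD[OF F]
    carrier_matD[OF L] carrier_matD[OF K] carrier_matD[OF \<xi>]
  have state: "s \<cdot>\<^sub>m \<xi> = (A + L * C) * \<xi> + (B * K - L)"
    using resolvent_eq_iff[OF AL dAL \<xi> BKL] by (simp add: \<xi>_def)
  have "- F * \<xi> + K = state_space_lft A (- L) B (- F) C s K * e"
  proof (rule state_space_lft_signals[OF A _ B _ C K dA dK \<xi> e K])
    show "s \<cdot>\<^sub>m \<xi> = A * \<xi> + (- L * e + B * K)"
      unfolding state e_def by (intro eq_matI) (simp_all add: mat_expand del: index_mult_mat(1))
    show "K = K * (C * \<xi> + e)"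
    proof -
      have "C * \<xi> + e = 1\<^sub>m p" unfolding e_def by (intro eq_matI) (simp_all del: index_mult_mat(1))
      then show ?thesis using K by simp
    qed
  qed (use L F in auto)
  moreover have "- F * \<xi> + K = v"
    unfolding v_def by (intro eq_matI) (simp_all add: mat_expand del: index_mult_mat(1))
  ultimately have v_eq: "v = Q * e" by (simp add: Q)
  have "F * \<xi> + v = state_space_lft (A + B * F + L * C) (- L) B F (- C) s Q * 1\<^sub>m p"
  proof (rule state_space_lft_signals[OF Ak _ B F _ Qc dAk dQ \<xi> _ v])
    show "s \<cdot>\<^sub>m \<xi> = (A + B * F + L * C) * \<xi> + (- L * 1\<^sub>m p + B * v)"
      unfolding state v_def by (intro eq_matI) (simp_all add: mat_expand del: index_mult_mat(1))
    have "- C * \<xi> + 1\<^sub>m p = e"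
      unfolding e_def by (intro eq_matI) (simp_all add: mat_expand del: index_mult_mat(1))
    then show "v = Q * (- C * \<xi> + 1\<^sub>m p)" using v_eq by simp
  qed (use L C in auto)
  moreover have "F * \<xi> + v = K"
    unfolding v_def by (intro eq_matI) (simp_all del: index_mult_mat(1))
  ultimately show ?thesis
    using state_space_lft_carrier[of "- L" n p F m] L F by (simp add: mat_one_mult)
qed

lemma plant_signals:
  assumes A: "A \<in> carrier_mat n n" and B: "B \<in> carrier_mat n m" and C: "C \<in> carrier_mat p n"
    and dA: "det (s \<cdot>\<^sub>m 1\<^sub>m n - A) \<noteq> 0"
    and x: "x \<in> carrier_mat n q" and u: "u \<in> carrier_mat m q"
    and state: "s \<cdot>\<^sub>m x = A * x + B * u"
  shows "C * x = C * inv_mat (s \<cdot>\<^sub>m 1\<^sub>m n - A) * B * u"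
proof -
  have R: "inv_mat (s \<cdot>\<^sub>m 1\<^sub>m n - A) \<in> carrier_mat n n"
    using A dA by (intro inv_mat_inverse(1)) (auto intro: minus_carrier_mat)
  have "x = inv_mat (s \<cdot>\<^sub>m 1\<^sub>m n - A) * (B * u)"
    using resolvent_eq_iff[OF A dA x, of "B * u"] state B u by simp
  then show ?thesis
    using carrier_matD[OF R] carrier_matD[OF B] carrier_matD[OF C] carrier_matD[OF u]
    by (simp add: mat_mult_assoc)
qed

text \<open>The signals of the closed loop with disturbances \<open>d1\<close> at the plant output and \<open>d2\<close> at the
  controller output. Here \<open>\<epsilon>\<close> is the estimation error, \<open>x\<close> the plant state and \<open>x - \<epsilon>\<close> the observer
  state. The formulas for the signals contain no inverses but the resolvents of \<open>A + L * C\<close> and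
  \<open>A + B * F\<close>.\<close>
lemma closed_loop_from_parameter:
  assumes A: "A \<in> carrier_mat n n" and B: "B \<in> carrier_mat n m" and C: "C \<in> carrier_mat p n"
    and F: "F \<in> carrier_mat m n" and L: "L \<in> carrier_mat n p" and Q: "Q \<in> carrier_mat m p"
    and d1: "d1 \<in> carrier_mat p q" and d2: "d2 \<in> carrier_mat m q"
    and dA: "det (s \<cdot>\<^sub>m 1\<^sub>m n - A) \<noteq> 0"
    and dAL: "det (s \<cdot>\<^sub>m 1\<^sub>m n - (A + L * C)) \<noteq> 0"
    and dAF: "det (s \<cdot>\<^sub>m 1\<^sub>m n - (A + B * F)) \<noteq> 0"
    and dAk: "det (s \<cdot>\<^sub>m 1\<^sub>m n - (A + B * F + L * C)) \<noteq> 0"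
    and dQ: "det (1\<^sub>m p - (- C) * inv_mat (s \<cdot>\<^sub>m 1\<^sub>m n - (A + B * F + L * C)) * B * Q) \<noteq> 0"
    and K: "K = state_space_lft (A + B * F + L * C) (- L) B F (- C) s Q"
  defines "\<epsilon> \<equiv> inv_mat (s \<cdot>\<^sub>m 1\<^sub>m n - (A + L * C)) * (L * d1 + B * d2)"
  defines "v \<equiv> Q * (C * \<epsilon> + d1)"
  defines "w \<equiv> v + d2 - F * \<epsilon>"
  defines "x \<equiv> inv_mat (s \<cdot>\<^sub>m 1\<^sub>m n - (A + B * F)) * (B * w)"
  defines "y \<equiv> C * x + d1"
  defines "u \<equiv> F * x + w"
  shows "y - C * inv_mat (s \<cdot>\<^sub>m 1\<^sub>m n - A) * B * u = d1" "u - K * y = d2"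
proof -
  have AL: "A + L * C \<in> carrier_mat n n" and AF: "A + B * F \<in> carrier_mat n n"
    and Ak: "A + B * F + L * C \<in> carrier_mat n n"
    using A B C F L by auto
  have R: "inv_mat (s \<cdot>\<^sub>m 1\<^sub>m n - (A + L * C)) \<in> carrier_mat n n"
    "inv_mat (s \<cdot>\<^sub>m 1\<^sub>m n - (A + B * F)) \<in> carrier_mat n n"
    using AL dAL AF dAF by (auto intro!: inv_mat_inverse(1) minus_carrier_mat)
  have dd: "L * d1 + B * d2 \<in> carrier_mat n q" using L B d1 d2 by auto
  have \<epsilon>: "\<epsilon> \<in> carrier_mat n q" using R dd by (auto simp: \<epsilon>_def)
  have v: "v \<in> carrier_mat m q" using Q C \<epsilon> d1 by (auto simp: v_def)
  have w: "w \<in> carrier_mat m q" using v d2 F \<epsilon> by (auto simp: w_def intro!: minus_carrier_mat)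
  have Bw: "B * w \<in> carrier_mat n q" using B w by auto
  have x: "x \<in> carrier_mat n q" using R Bw by (auto simp: x_def)
  have y: "y \<in> carrier_mat p q" and u: "u \<in> carrier_mat m q"
    using C F x d1 w by (auto simp: y_def u_def)
  have Kc: "K \<in> carrier_mat m p"
    using state_space_lft_carrier[of "- L" n p F m] L F by (auto simp: K)
  note dims [simp] = carrier_matD[OF A] carrier_matD[OF B] carrier_matD[OF C] carrier_matD[OF F]
    carrier_matD[OF L] carrier_matD[OF Kc] carrier_matD[OF \<epsilon>] carrier_matD[OF v] carrier_matD[OF w]
    carrier_matD[OF x] carrier_matD[OF y] carrier_matD[OF u] carrier_matD[OF d1] carrier_matD[OF d2]
  have \<epsilon>_state: "s \<cdot>\<^sub>m \<epsilon> = (A + L * C) * \<epsilon> + (L * d1 + B * d2)"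
    using resolvent_eq_iff[OF AL dAL \<epsilon> dd] by (simp add: \<epsilon>_def)
  have x_state: "s \<cdot>\<^sub>m x = (A + B * F) * x + B * w"
    using resolvent_eq_iff[OF AF dAF x Bw] by (simp add: x_def)
  have "s \<cdot>\<^sub>m x = A * x + B * u"
    unfolding x_state u_def by (intro eq_matI) (simp_all add: mat_expand del: index_mult_mat(1))
  from plant_signals[OF A B C dA x u this]
  show "y - C * inv_mat (s \<cdot>\<^sub>m 1\<^sub>m n - A) * B * u = d1"
    unfolding y_def by (intro eq_matI) (auto simp del: index_mult_mat(1))
  have Ky: "F * (x - \<epsilon>) + v = K * y"
    unfolding K
  proof (rule state_space_lft_signals[OF Ak _ B F _ Q dAk dQ _ y v])
    show "s \<cdot>\<^sub>m (x - \<epsilon>) = (A + B * F + L * C) * (x - \<epsilon>) + (- L * y + B * v)"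
      by (intro eq_matI)
        (simp_all add: smult_mat_distribs x_state \<epsilon>_state y_def w_def mat_expand del: index_mult_mat(1) index_smult_mat(1))
    have "- C * (x - \<epsilon>) + y = C * \<epsilon> + d1"
      unfolding y_def by (intro eq_matI) (simp_all add: mat_expand del: index_mult_mat(1))
    then show "v = Q * (- C * (x - \<epsilon>) + y)" by (simp add: v_def)
  qed (use L C \<epsilon> in \<open>auto intro: minus_carrier_mat\<close>)
  show "u - K * y = d2"
    unfolding Ky[symmetric] u_def w_def
    by (intro eq_matI) (simp_all add: mat_expand del: index_mult_mat(1))
qed

text \<open>The converse construction. The disturbances \<open>d1\<close> and \<open>d2\<close>, stable functions of \<open>\<zeta>\<close>, are chosen such
  that the estimation error is \<open>- \<zeta>\<close> and the signal \<open>e = C \<epsilon> + d1\<close> entering the parameter is the identity.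
  The parameter is then read off as \<open>v = u - F x\<close>, where the plant state \<open>x\<close> is reconstructed from
  \<open>u\<close> and \<open>y\<close> by the stable observer with the state matrix \<open>A + L * C\<close>.\<close>
lemma parameter_from_closed_loop:
  assumes A: "A \<in> carrier_mat n n" and B: "B \<in> carrier_mat n m" and C: "C \<in> carrier_mat p n"
    and F: "F \<in> carrier_mat m n" and L: "L \<in> carrier_mat n p" and K: "K \<in> carrier_mat m p"
    and y: "y \<in> carrier_mat p p" and u: "u \<in> carrier_mat m p"
    and dA: "det (s \<cdot>\<^sub>m 1\<^sub>m n - A) \<noteq> 0"
    and dAL: "det (s \<cdot>\<^sub>m 1\<^sub>m n - (A + L * C)) \<noteq> 0"
    and dAF: "det (s \<cdot>\<^sub>m 1\<^sub>m n - (A + B * F)) \<noteq> 0"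
    and dK: "det (1\<^sub>m p - C * inv_mat (s \<cdot>\<^sub>m 1\<^sub>m n - A) * B * K) \<noteq> 0"
  defines "\<zeta> \<equiv> - (inv_mat (s \<cdot>\<^sub>m 1\<^sub>m n - (A + B * F)) * L)"
  defines "d1 \<equiv> 1\<^sub>m p + C * \<zeta>"
  defines "d2 \<equiv> - (F * \<zeta>)"
  assumes yu: "y - C * inv_mat (s \<cdot>\<^sub>m 1\<^sub>m n - A) * B * u = d1" "u - K * y = d2"
  shows "u - F * (inv_mat (s \<cdot>\<^sub>m 1\<^sub>m n - (A + L * C)) * (B * u - L * y + L * d1)) =
    state_space_lft A (- L) B (- F) C s K"
proof -
  have AL: "A + L * C \<in> carrier_mat n n" and AF: "A + B * F \<in> carrier_mat n n"
    using A B C F L by auto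
  have R: "inv_mat (s \<cdot>\<^sub>m 1\<^sub>m n - A) \<in> carrier_mat n n"
    "inv_mat (s \<cdot>\<^sub>m 1\<^sub>m n - (A + B * F)) \<in> carrier_mat n n"
    using A dA AF dAF by (auto intro!: inv_mat_inverse(1) minus_carrier_mat)
  have \<zeta>: "\<zeta> \<in> carrier_mat n p" using R L by (auto simp: \<zeta>_def)
  have d1: "d1 \<in> carrier_mat p p" and d2: "d2 \<in> carrier_mat m p"
    using C F \<zeta> by (auto simp: d1_def d2_def)
  define x where "x = inv_mat (s \<cdot>\<^sub>m 1\<^sub>m n - A) * (B * u)"
  have Bu: "B * u \<in> carrier_mat n p" using B u by auto
  have x: "x \<in> carrier_mat n p" using R Bu by (auto simp: x_def)
  have u2: "u - d2 \<in> carrier_mat m p" using d2 by (auto intro: minus_carrier_mat)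
  have inj: "B * u - L * y + L * d1 \<in> carrier_mat n p"
    using L d1 by (auto simp del: index_mult_mat(1))
  note dims [simp] = carrier_matD[OF A] carrier_matD[OF B] carrier_matD[OF C] carrier_matD[OF F]
    carrier_matD[OF L] carrier_matD[OF K] carrier_matD[OF \<zeta>] carrier_matD[OF R(1)]
    carrier_matD[OF x] carrier_matD[OF y] carrier_matD[OF u] carrier_matD[OF d1] carrier_matD[OF d2]
  have x_state: "s \<cdot>\<^sub>m x = A * x + B * u"
    using resolvent_eq_iff[OF A dA x Bu] by (simp add: x_def)
  have y_eq: "y = C * x + d1"
  proof -
    have "y - C * x = d1"
      using yu(1) unfolding plant_signals[OF A B C dA x u x_state] .
    moreover have "y = C * x + (y - C * x)"
      by (intro eq_matI) (simp_all del: index_mult_mat(1))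
    ultimately show ?thesis by simp
  qed
  have "s \<cdot>\<^sub>m x = (A + L * C) * x + (B * u - L * y + L * d1)"
    unfolding x_state y_eq by (intro eq_matI) (simp_all add: mat_expand del: index_mult_mat(1))
  then have x_eq: "x = inv_mat (s \<cdot>\<^sub>m 1\<^sub>m n - (A + L * C)) * (B * u - L * y + L * d1)"
    using resolvent_eq_iff[OF AL dAL x inj] by simp
  have \<zeta>_state: "s \<cdot>\<^sub>m \<zeta> = (A + B * F) * \<zeta> + - L"
  proof -
    have "\<zeta> = inv_mat (s \<cdot>\<^sub>m 1\<^sub>m n - (A + B * F)) * - L"
      using carrier_matD[OF R(2)] by (simp add: \<zeta>_def mat_uminus_mult)
    then show ?thesis using resolvent_eq_iff[OF AF dAF \<zeta>, of "- L"] L by simp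
  qed
  \<comment> \<open>The observer state is \<open>x - \<epsilon> = x + \<zeta>\<close>, and \<open>u - d2\<close> is the undisturbed controller output.\<close>
  have "- F * (x + \<zeta>) + (u - d2) = state_space_lft A (- L) B (- F) C s K * 1\<^sub>m p"
  proof (rule state_space_lft_signals[OF A _ B _ C K dA dK _ _ u2])
    show "s \<cdot>\<^sub>m (x + \<zeta>) = A * (x + \<zeta>) + (- L * 1\<^sub>m p + B * (u - d2))"
      by (intro eq_matI)
        (simp_all add: smult_mat_distribs x_state \<zeta>_state d2_def mat_expand del: index_mult_mat(1) index_smult_mat(1))
    have "C * (x + \<zeta>) + 1\<^sub>m p = y"
      unfolding y_eq d1_def by (intro eq_matI) (simp_all add: mat_expand del: index_mult_mat(1))
    moreover have "u - d2 = K * y"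
      unfolding yu(2)[symmetric] by (intro eq_matI) (simp_all del: index_mult_mat(1))
    ultimately show "u - d2 = K * (C * (x + \<zeta>) + 1\<^sub>m p)" by simp
  qed (use L F x \<zeta> in auto)
  moreover have "- F * (x + \<zeta>) + (u - d2) = u - F * x"
    unfolding d2_def by (intro eq_matI) (simp_all add: mat_expand del: index_mult_mat(1))
  ultimately show ?thesis
    using state_space_lft_carrier[of "- L" n p "- F" m] L F unfolding x_eq[symmetric] by (simp add: mat_one_mult)
qed

section \<open>Block structure of realizations\<close>
lemma cmat_add: "A \<in> carrier_mat r c \<Longrightarrow> B \<in> carrier_mat r c \<Longrightarrow> cmat (A + B) = cmat A + cmat B"
  by (intro eq_matI) auto

lemma cmat_uminus: "cmat (- A) = - cmat A"
  by (intro eq_matI) auto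

lemma cmat_zero: "cmat (0\<^sub>m m n) = 0\<^sub>m m n"
  by (intro eq_matI) auto

lemma split_block_four_block:
  assumes "A \<in> carrier_mat r1 c1" "B \<in> carrier_mat r1 c2" "C \<in> carrier_mat r2 c1" "D \<in> carrier_mat r2 c2"
  shows "split_block (four_block_mat A B C D) r1 c1 = (A, B, C, D)"
  using assms unfolding split_block_def Let_def by (auto intro!: eq_matI)

lemma lft_four_block:
  assumes "A \<in> carrier_mat r c" "B \<in> carrier_mat r m" "C \<in> carrier_mat p c" "D \<in> carrier_mat p m"
    and "Q \<in> carrier_mat m p"
  shows "lft (four_block_mat A B C D) Q = A + B * Q * inv_mat (1\<^sub>m p - D * Q) * C"
  using assms split_block_four_block[OF assms(1-4)] unfolding lft_def by auto

lemma lower_right_four_block: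
  assumes "A \<in> carrier_mat r c" "B \<in> carrier_mat r m" "C \<in> carrier_mat p c" "D \<in> carrier_mat p m"
  shows "lower_right p m (four_block_mat A B C D) = D"
  using assms split_block_four_block[OF assms(1-4)] unfolding lower_right_def by auto

text \<open>The four blocks share the resolvent of \<open>A\<close>. This also reduces \<open>plant\<close> and \<open>youla_J\<close>, which are
  defined by one realization, to their blocks.\<close>
lemma realization_four_block:
  assumes A: "A \<in> carrier_mat n n" and B: "B1 \<in> carrier_mat n m1" "B2 \<in> carrier_mat n m2"
    and C: "C1 \<in> carrier_mat p1 n" "C2 \<in> carrier_mat p2 n"
    and D: "D11 \<in> carrier_mat p1 m1" "D12 \<in> carrier_mat p1 m2" "D21 \<in> carrier_mat p2 m1" "D22 \<in> carrier_mat p2 m2"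
    and d: "det (s \<cdot>\<^sub>m 1\<^sub>m n - cmat A) \<noteq> 0"
  shows "realization A (append_cols B1 B2) (C1 @\<^sub>r C2) (four_block_mat D11 D12 D21 D22) s =
    four_block_mat (realization A B1 C1 D11 s) (realization A B2 C1 D12 s)
      (realization A B1 C2 D21 s) (realization A B2 C2 D22 s)"
proof -
  have cA: "cmat A \<in> carrier_mat n n" using A by simp
  have R: "inv_mat (s \<cdot>\<^sub>m 1\<^sub>m n - cmat A) \<in> carrier_mat n n"
    using cA d by (intro inv_mat_inverse(1)) (auto intro: minus_carrier_mat)
  have entry: "realization A B C D s $$ (i, j) = complex_of_real (D $$ (i, j)) +
      (\<Sum>k<n. (\<Sum>l<n. complex_of_real (C $$ (i, l)) * inv_mat (s \<cdot>\<^sub>m 1\<^sub>m n - cmat A) $$ (l, k)) *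
        complex_of_real (B $$ (k, j)))"
    if "B \<in> carrier_mat n m" "C \<in> carrier_mat p n" "D \<in> carrier_mat p m" "i < p" "j < m"
    for B C D :: "real mat" and m p i j
  proof -
    have "(cmat C * inv_mat (s \<cdot>\<^sub>m 1\<^sub>m n - cmat A) * cmat B) $$ (i, j) =
      (\<Sum>k<n. (cmat C * inv_mat (s \<cdot>\<^sub>m 1\<^sub>m n - cmat A)) $$ (i, k) * cmat B $$ (k, j))"
      using that R by (intro index_mult_mat_sum[where r = p and c = m]) auto
    also have "\<dots> = (\<Sum>k<n. (\<Sum>l<n. cmat C $$ (i, l) * inv_mat (s \<cdot>\<^sub>m 1\<^sub>m n - cmat A) $$ (l, k)) *
        cmat B $$ (k, j))"
      using that R by (intro sum.cong refl arg_cong2[where f = times]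
          index_mult_mat_sum[where r = p and c = n]) auto
    finally show ?thesis
      using that A R by (simp add: realization_def del: index_mult_mat(1))
  qed
  have cars: "append_cols B1 B2 \<in> carrier_mat n (m1 + m2)" "C1 @\<^sub>r C2 \<in> carrier_mat (p1 + p2) n"
    "four_block_mat D11 D12 D21 D22 \<in> carrier_mat (p1 + p2) (m1 + m2)"
    using B C D unfolding append_cols_def append_rows_def by auto
  have dims: "dim_row (realization A X Y Z s) = dim_row Y" "dim_col (realization A X Y Z s) = dim_col X"
    if "dim_row Z = dim_row Y" "dim_col Z = dim_col X" for X Y Z
    using that by (simp_all add: realization_def)
  show ?thesis
  proof (rule eq_matI)
    fix i j
    assume "i < dim_row (four_block_mat (realization A B1 C1 D11 s) (realization A B2 C1 D12 s)
      (realization A B1 C2 D21 s) (realization A B2 C2 D22 s))"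
      "j < dim_col (four_block_mat (realization A B1 C1 D11 s) (realization A B2 C1 D12 s)
      (realization A B1 C2 D21 s) (realization A B2 C2 D22 s))"
    then have ij: "i < p1 + p2" "j < m1 + m2" using B C D by (auto simp: dims)
    have c: "(C1 @\<^sub>r C2) $$ (i, l) = (if i < p1 then C1 $$ (i, l) else C2 $$ (i - p1, l))" if "l < n" for l
      using C ij that by (auto simp: append_rows_def)
    have b: "append_cols B1 B2 $$ (k, j) = (if j < m1 then B1 $$ (k, j) else B2 $$ (k, j - m1))" if "k < n" for k
      using B ij that by (auto simp: append_cols_def)
    show "realization A (append_cols B1 B2) (C1 @\<^sub>r C2) (four_block_mat D11 D12 D21 D22) s $$ (i, j) =
      four_block_mat (realization A B1 C1 D11 s) (realization A B2 C1 D12 s)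
        (realization A B1 C2 D21 s) (realization A B2 C2 D22 s) $$ (i, j)"
      unfolding entry[OF cars ij] using ij B C D
      by (auto simp: dims entry[of _ m1 _ p1] entry[of _ m2 _ p1] entry[of _ m1 _ p2] entry[of _ m2 _ p2] c b)
  qed (use B C D carrier_matD[OF cars(1)] carrier_matD[OF cars(2)] in \<open>simp_all add: dims\<close>)
qed

section \<open>Feedback loops of transfer matrices\<close>

lemma vanishing_transfer:
  assumes "A \<in> carrier_mat n n" "B \<in> carrier_mat n m" "C \<in> carrier_mat p n"
  shows "vanishing p m (\<lambda>s. C * inv_mat (s \<cdot>\<^sub>m 1\<^sub>m n - A) * B)"
  using assms
  by (intro vanishing_mult_right[where n = n] vanishing_mult_left[where n = n] vanishing_resolvent L_prop_const) auto

text \<open>A loop around a strictly proper system is well-posed for every proper \<open>K\<close>.\<close>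
lemma eventually_loop_invertible:
  assumes "A \<in> carrier_mat n n" "B \<in> carrier_mat n m" "C \<in> carrier_mat p n" "K \<in> L_prop m p"
  shows "\<forall>\<^sub>F s in right_half_planes. det (1\<^sub>m p - C * inv_mat (s \<cdot>\<^sub>m 1\<^sub>m n - A) * B * K s) \<noteq> 0"
proof -
  have half: "0 < (1/2 :: real)" by simp
  show ?thesis
    using vanishing_row_sums[OF vanishing_mult_right[OF vanishing_transfer[OF assms(1-3)] assms(4)] half]
    by eventually_elim (use det_one_minus_dominant_nonzero in blast)
qed

text \<open>The inverse of this matrix maps the two disturbances of the loop to the signals \<open>y\<close> and \<open>u\<close>.\<close>
lemma loop_mult_append_rows:
  fixes G :: "'a :: ring_1 mat"
  assumes "G \<in> carrier_mat p m" "K \<in> carrier_mat m p" "y \<in> carrier_mat p q" "u \<in> carrier_mat m q"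
  shows "four_block_mat (1\<^sub>m p) (- G) (- K) (1\<^sub>m m) * (y @\<^sub>r u) = (y - G * u) @\<^sub>r (u - K * y)"
proof -
  have "four_block_mat (1\<^sub>m p) (- G) (- K) (1\<^sub>m m) * (y @\<^sub>r u) =
    four_block_mat (1\<^sub>m p * y + - G * u) (1\<^sub>m p * 0\<^sub>m p 0 + - G * 0\<^sub>m m 0)
      (- K * y + 1\<^sub>m m * u) (- K * 0\<^sub>m p 0 + 1\<^sub>m m * 0\<^sub>m m 0)"
    using assms unfolding append_rows_def
    by (subst mult_four_block_mat[where ?nr1.0 = p and ?nr2.0 = m and ?n1.0 = p and ?n2.0 = m and ?nc1.0 = q and ?nc2.0 = 0]) auto
  also have "\<dots> = (y - G * u) @\<^sub>r (u - K * y)"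
    unfolding append_rows_def using assms
    by (intro cong_four_block_mat) (auto intro!: eq_matI simp: mat_expand simp del: index_mult_mat(1))
  finally show ?thesis .
qed

lemma append_rows_inject:
  assumes "a \<in> carrier_mat r1 c" "a' \<in> carrier_mat r1 c" "b \<in> carrier_mat r2 c" "b' \<in> carrier_mat r2 c"
    and eq: "a @\<^sub>r b = a' @\<^sub>r b'"
  shows "a = a'" "b = b'"
proof -
  show "a = a'"
  proof (rule eq_matI)
    fix i j assume "i < dim_row a'" "j < dim_col a'"
    then show "a $$ (i, j) = a' $$ (i, j)"
      using assms(1-4) arg_cong[OF eq, of "\<lambda>M. M $$ (i, j)"] by (auto simp: append_rows_def)
  qed (use assms in auto)
  show "b = b'"
  proof (rule eq_matI)
    fix i j assume "i < dim_row b'" "j < dim_col b'"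
    then show "b $$ (i, j) = b' $$ (i, j)"
      using assms(1-4) arg_cong[OF eq, of "\<lambda>M. M $$ (r1 + i, j)"] by (auto simp: append_rows_def)
  qed (use assms in auto)
qed

lemma analytic_bounded_append_rows:
  assumes "analytic_bounded r1 c \<alpha> G" "analytic_bounded r2 c \<alpha> H"
  shows "analytic_bounded (r1 + r2) c \<alpha> (\<lambda>s. G s @\<^sub>r H s)"
proof (rule analytic_bounded_entrywise)
  fix s i j assume "Re s > \<alpha>" "i < r1 + r2" "j < c"
  then show "(G s @\<^sub>r H s) $$ (i, j) = (if i < r1 then (\<lambda>s. G s $$ (i, j)) else (\<lambda>s. H s $$ (i - r1, j))) s"
    using assms[THEN analytic_bounded_carrier, of s] by (auto simp: append_rows_def)
next
  fix i j assume "i < r1 + r2" "j < c"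
  then show "bounded_hol \<alpha> (if i < r1 then (\<lambda>s. G s $$ (i, j)) else (\<lambda>s. H s $$ (i - r1, j)))"
    using analytic_bounded_entry[OF assms(1), of i j] analytic_bounded_entry[OF assms(2), of "i - r1" j]
    by auto
qed (use assms in \<open>auto dest: analytic_bounded_carrier\<close>)

text \<open>Unlike \<open>split_block\<close>, this takes rows only, so that the number of columns does not enter.\<close>
definition row_slice :: "nat \<Rightarrow> nat \<Rightarrow> 'a mat \<Rightarrow> 'a mat" where
  "row_slice k r M = Matrix.mat r (dim_col M) (\<lambda>(i, j). M $$ (k + i, j))"

lemma row_slice_append_rows:
  "M \<in> carrier_mat (r1 + r2) c \<Longrightarrow> row_slice 0 r1 M @\<^sub>r row_slice r1 r2 M = M"
  by (intro eq_matI) (auto simp: row_slice_def append_rows_def)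

lemma analytic_bounded_row_slice:
  assumes "analytic_bounded r c \<alpha> G" "k + r' \<le> r"
  shows "analytic_bounded r' c \<alpha> (\<lambda>s. row_slice k r' (G s))"
proof (rule analytic_bounded_entrywise)
  fix s i j assume "Re s > \<alpha>" "i < r'" "j < c"
  then show "row_slice k r' (G s) $$ (i, j) = G s $$ (k + i, j)"
    using assms(1)[THEN analytic_bounded_carrier, of s] by (auto simp: row_slice_def)
next
  fix s assume "Re s > \<alpha>"
  then show "row_slice k r' (G s) \<in> carrier_mat r' c"
    using assms(1)[THEN analytic_bounded_carrier, of s] by (auto simp: row_slice_def)
qed (use assms in \<open>auto intro!: analytic_bounded_entry[OF assms(1)]\<close>)

text \<open>A right inverse of a square matrix is its inverse, so stabilization amounts to the solvability of
  one linear equation in \<open>H_inf\<close>.\<close>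
lemma stabilizes_plant_iff:
  assumes A: "A \<in> carrier_mat n n" and B: "B1 \<in> carrier_mat n w" "B2 \<in> carrier_mat n m"
    and C: "C1 \<in> carrier_mat z n" "C2 \<in> carrier_mat p n"
    and D: "D12 \<in> carrier_mat z m" "D21 \<in> carrier_mat p w"
    and K: "K \<in> L_prop m p"
  shows "stabilizes m p K (plant A B1 B2 C1 C2 D12 D21) \<longleftrightarrow>
    (\<exists>H \<in> H_inf (p + m) (p + m). \<forall>\<^sub>F s in right_half_planes.
       four_block_mat (1\<^sub>m p) (- (cmat C2 * inv_mat (s \<cdot>\<^sub>m 1\<^sub>m n - cmat A) * cmat B2)) (- K s) (1\<^sub>m m) * H s =
         1\<^sub>m (p + m))"
proof -
  have cA: "cmat A \<in> carrier_mat n n" using A by simp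
  let ?G = "\<lambda>s. cmat C2 * inv_mat (s \<cdot>\<^sub>m 1\<^sub>m n - cmat A) * cmat B2"
  have P22: "\<forall>\<^sub>F s in right_half_planes. lower_right p m (plant A B1 B2 C1 C2 D12 D21 s) = ?G s"
    using eventually_resolvent[OF cA]
  proof eventually_elim
    case (elim s)
    have R: "inv_mat (s \<cdot>\<^sub>m 1\<^sub>m n - cmat A) \<in> carrier_mat n n"
      using cA elim by (intro inv_mat_inverse(1)) (auto intro: minus_carrier_mat)
    have car: "realization A X Y Z s \<in> carrier_mat r c"
      if "Y \<in> carrier_mat r n" "X \<in> carrier_mat n c" "Z \<in> carrier_mat r c" for X Y Z r c
      using that R A unfolding realization_def by auto
    have "plant A B1 B2 C1 C2 D12 D21 s =
      four_block_mat (realization A B1 C1 (0\<^sub>m z w) s) (realization A B2 C1 D12 s)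
        (realization A B1 C2 D21 s) (realization A B2 C2 (0\<^sub>m p m) s)"
      unfolding plant_def using A B C D elim by (simp add: realization_four_block)
    then have "lower_right p m (plant A B1 B2 C1 C2 D12 D21 s) = realization A B2 C2 (0\<^sub>m p m) s"
      using B C D by (simp add: lower_right_four_block[where r = z and c = w] car)
    also have "\<dots> = ?G s"
      using A B C R unfolding realization_def
      by (intro eq_matI) (auto simp del: index_mult_mat(1))
    finally show ?case .
  qed
  have "(\<forall>\<^sub>F s in right_half_planes. mat_inverse (four_block_mat (1\<^sub>m p)
        (- lower_right p m (plant A B1 B2 C1 C2 D12 D21 s)) (- K s) (1\<^sub>m m)) = Some (H s)) \<longleftrightarrow>
      (\<forall>\<^sub>F s in right_half_planes. four_block_mat (1\<^sub>m p) (- ?G s) (- K s) (1\<^sub>m m) * H s = 1\<^sub>m (p + m))"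
    if H: "H \<in> H_inf (p + m) (p + m)" for H
  proof (rule eventually_cong)
    have Hc: "\<forall>\<^sub>F s in right_half_planes. H s \<in> carrier_mat (p + m) (p + m)"
      using H H_inf_subset_L_prop by (intro L_prop_eventually_carrier) auto
    show "\<forall>\<^sub>F s in right_half_planes. (mat_inverse (four_block_mat (1\<^sub>m p)
        (- lower_right p m (plant A B1 B2 C1 C2 D12 D21 s)) (- K s) (1\<^sub>m m)) = Some (H s)) \<longleftrightarrow>
      (four_block_mat (1\<^sub>m p) (- ?G s) (- K s) (1\<^sub>m m) * H s = 1\<^sub>m (p + m))"
      using P22 Hc
    proof eventually_elim
      case (elim s)
      let ?M = "four_block_mat (1\<^sub>m p) (- ?G s) (- K s) (1\<^sub>m m)"
      have M: "?M \<in> carrier_mat (p + m) (p + m)" by auto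
      have "mat_inverse ?M = Some (H s)" if "?M * H s = 1\<^sub>m (p + m)"
        using inv_mat_inverse(4)[OF M det_nonzero_if_right_inverse[OF M elim(2) that]]
          inv_mat_eqI[OF M elim(2) that] by simp
      moreover have "?M * H s = 1\<^sub>m (p + m)" if "mat_inverse ?M = Some (H s)"
        using mat_inverse(2)[OF M that] by simp
      ultimately show ?case unfolding elim(1) by blast
    qed
  qed auto
  then show ?thesis unfolding stabilizes_def by (intro bex_cong) auto
qed


section \<open>Controllers given by linear fractional transformations\<close>
lemma lft_realization:
  assumes A: "A \<in> carrier_mat n n" and B: "B1 \<in> carrier_mat n p" "B2 \<in> carrier_mat n m"
    and C: "C1 \<in> carrier_mat m n" "C2 \<in> carrier_mat p n" and Q: "Q \<in> carrier_mat m p"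
    and d: "det (s \<cdot>\<^sub>m 1\<^sub>m n - cmat A) \<noteq> 0"
  shows "lft (realization A (append_cols B1 B2) (C1 @\<^sub>r C2)
      (four_block_mat (0\<^sub>m m p) (1\<^sub>m m) (1\<^sub>m p) (0\<^sub>m p m)) s) Q =
    state_space_lft (cmat A) (cmat B1) (cmat B2) (cmat C1) (cmat C2) s Q"
proof -
  have cA: "cmat A \<in> carrier_mat n n" using A by simp
  have R: "inv_mat (s \<cdot>\<^sub>m 1\<^sub>m n - cmat A) \<in> carrier_mat n n"
    using cA d by (intro inv_mat_inverse(1)) (auto intro: minus_carrier_mat)
  have r: "realization A B1 C1 (0\<^sub>m m p) s = cmat C1 * inv_mat (s \<cdot>\<^sub>m 1\<^sub>m n - cmat A) * cmat B1"
    "realization A B2 C1 (1\<^sub>m m) s = 1\<^sub>m m + cmat C1 * inv_mat (s \<cdot>\<^sub>m 1\<^sub>m n - cmat A) * cmat B2"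
    "realization A B1 C2 (1\<^sub>m p) s = 1\<^sub>m p + cmat C2 * inv_mat (s \<cdot>\<^sub>m 1\<^sub>m n - cmat A) * cmat B1"
    "realization A B2 C2 (0\<^sub>m p m) s = cmat C2 * inv_mat (s \<cdot>\<^sub>m 1\<^sub>m n - cmat A) * cmat B2"
    using A B C unfolding realization_def
    by (auto simp: of_real_hom.mat_hom_one cmat_zero intro!: eq_matI simp del: index_mult_mat(1))
  have "cmat C1 * inv_mat (s \<cdot>\<^sub>m 1\<^sub>m n - cmat A) * cmat B1 \<in> carrier_mat m p"
    "1\<^sub>m m + cmat C1 * inv_mat (s \<cdot>\<^sub>m 1\<^sub>m n - cmat A) * cmat B2 \<in> carrier_mat m m"
    "1\<^sub>m p + cmat C2 * inv_mat (s \<cdot>\<^sub>m 1\<^sub>m n - cmat A) * cmat B1 \<in> carrier_mat p p"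
    "cmat C2 * inv_mat (s \<cdot>\<^sub>m 1\<^sub>m n - cmat A) * cmat B2 \<in> carrier_mat p m"
    using B C R by auto
  from lft_four_block[OF this Q] show ?thesis
    unfolding state_space_lft_def Let_def using A B C
    by (subst realization_four_block[OF A B C _ _ _ _ d]) (auto simp: r)
qed

text \<open>All coefficients are block-diagonal, and the loop gain \<open>C2 \<Phi> B2 K\<close> has a strictly proper
  block-diagonal factor. So the transformation is built from the operations that preserve
  \<open>S_delay\<close>.\<close>
lemma S_delay_state_space_lft:
  assumes \<tau>: "\<tau> \<ge> 0"
    and A: "A \<in> carrier_mat (tot N q) (tot N q)" "pattern (=) q q A"
    and B1: "B1 \<in> carrier_mat (tot N q) (tot N c)" "pattern (=) q c B1"
    and B2: "B2 \<in> carrier_mat (tot N q) (tot N r)" "pattern (=) q r B2"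
    and C1: "C1 \<in> carrier_mat (tot N r) (tot N q)" "pattern (=) r q C1"
    and C2: "C2 \<in> carrier_mat (tot N c) (tot N q)" "pattern (=) c q C2"
    and K: "K \<in> S_delay N r c E \<tau>"
  shows "(\<lambda>s. state_space_lft (cmat A) (cmat B1) (cmat B2) (cmat C1) (cmat C2) s (K s)) \<in> S_delay N r c E \<tau>"
proof -
  let ?n = "tot N q" and ?m = "tot N r" and ?p = "tot N c"
  have one: "pattern (=) a a (1\<^sub>m k :: real mat)" for a k by (rule pattern_one) simp
  note real = S_delay_realization[OF \<tau> A(1) _ _ _ A(2)]
  have J: "realization A B1 C1 (0\<^sub>m ?m ?p) \<in> S_delay N r c E \<tau>"
    "realization A B2 C1 (1\<^sub>m ?m) \<in> S_delay N r r E \<tau>"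
    "realization A B1 C2 (1\<^sub>m ?p) \<in> S_delay N c c E \<tau>"
    using B1 B2 C1 C2 by (auto intro!: real one pattern_zero)
  have inv: "(\<lambda>s. inv_mat (1\<^sub>m ?p - realization A B2 C2 (0\<^sub>m ?p ?m) s * K s)) \<in> S_delay N c c E \<tau>"
    using A B2 C2 by (intro S_delay_inverse[OF \<tau> vanishing_realization _ K] pattern_realization pattern_zero) auto
  have "(\<lambda>s. realization A B1 C1 (0\<^sub>m ?m ?p) s + realization A B2 C1 (1\<^sub>m ?m) s * K s *
      inv_mat (1\<^sub>m ?p - realization A B2 C2 (0\<^sub>m ?p ?m) s * K s) * realization A B1 C2 (1\<^sub>m ?p) s)
      \<in> S_delay N r c E \<tau>"
    by (rule S_delay_add[OF \<tau> J(1) S_delay_mult[OF \<tau> S_delay_mult[OF \<tau> S_delay_mult[OF \<tau> J(2) K] inv] J(3)]])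
  moreover have r: "realization A B1 C1 (0\<^sub>m ?m ?p) s = cmat C1 * inv_mat (s \<cdot>\<^sub>m 1\<^sub>m ?n - cmat A) * cmat B1"
    "realization A B2 C1 (1\<^sub>m ?m) s = 1\<^sub>m ?m + cmat C1 * inv_mat (s \<cdot>\<^sub>m 1\<^sub>m ?n - cmat A) * cmat B2"
    "realization A B1 C2 (1\<^sub>m ?p) s = 1\<^sub>m ?p + cmat C2 * inv_mat (s \<cdot>\<^sub>m 1\<^sub>m ?n - cmat A) * cmat B1"
    "realization A B2 C2 (0\<^sub>m ?p ?m) s = cmat C2 * inv_mat (s \<cdot>\<^sub>m 1\<^sub>m ?n - cmat A) * cmat B2" for s
    using A B1 B2 C1 C2 unfolding realization_def
    by (auto simp: of_real_hom.mat_hom_one cmat_zero intro!: eq_matI simp del: index_mult_mat(1))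
  ultimately show ?thesis
    using A C1 C2 by (simp add: state_space_lft_def Let_def)
qed

section \<open>Stabilizing controllers and stable parameters\<close>

text \<open>Running the closed loop on the identity matrix, split into its upper and lower rows as the two
  disturbances, produces all columns of the closed-loop map at once.\<close>
lemma stabilizing_if_parameter:
  assumes A: "A \<in> carrier_mat n n" and B: "B \<in> carrier_mat n m" and C: "C \<in> carrier_mat p n"
    and F: "F \<in> carrier_mat m n" and L: "L \<in> carrier_mat n p"
    and \<Gamma>: "\<And>s. Re s > 0 \<Longrightarrow> det (s \<cdot>\<^sub>m 1\<^sub>m n - (A + B * F)) \<noteq> 0"
      "(\<lambda>s. inv_mat (s \<cdot>\<^sub>m 1\<^sub>m n - (A + B * F))) \<in> H_inf n n"
    and \<Lambda>: "\<And>s. Re s > 0 \<Longrightarrow> det (s \<cdot>\<^sub>m 1\<^sub>m n - (A + L * C)) \<noteq> 0"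
      "(\<lambda>s. inv_mat (s \<cdot>\<^sub>m 1\<^sub>m n - (A + L * C))) \<in> H_inf n n"
    and Q: "Q \<in> H_inf m p"
    and K: "\<forall>\<^sub>F s in right_half_planes. K s = state_space_lft (A + B * F + L * C) (- L) B F (- C) s (Q s)"
  shows "\<exists>H \<in> H_inf (p + m) (p + m). \<forall>\<^sub>F s in right_half_planes.
    four_block_mat (1\<^sub>m p) (- (C * inv_mat (s \<cdot>\<^sub>m 1\<^sub>m n - A) * B)) (- K s) (1\<^sub>m m) * H s = 1\<^sub>m (p + m)"
proof -
  define d1 :: "complex mat" where "d1 = row_slice 0 p (1\<^sub>m (p + m))"
  define d2 :: "complex mat" where "d2 = row_slice p m (1\<^sub>m (p + m))"
  have d: "d1 \<in> carrier_mat p (p + m)" "d2 \<in> carrier_mat m (p + m)"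
    by (auto simp: d1_def d2_def row_slice_def)
  have dd: "d1 @\<^sub>r d2 = 1\<^sub>m (p + m)"
    unfolding d1_def d2_def by (rule row_slice_append_rows[where c = "p + m"]) simp
  define \<epsilon> where "\<epsilon> s = inv_mat (s \<cdot>\<^sub>m 1\<^sub>m n - (A + L * C)) * (L * d1 + B * d2)" for s
  define v where "v s = Q s * (C * \<epsilon> s + d1)" for s
  define w where "w s = v s + d2 - F * \<epsilon> s" for s
  define x where "x s = inv_mat (s \<cdot>\<^sub>m 1\<^sub>m n - (A + B * F)) * (B * w s)" for s
  define y where "y s = C * x s + d1" for s
  define u where "u s = F * x s + w s" for s
  have \<epsilon>: "analytic_bounded n (p + m) 0 \<epsilon>"
    unfolding \<epsilon>_def[abs_def] using \<Lambda>(2) L B d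
    by (auto simp: H_inf_def intro!: analytic_bounded_intros)
  have v: "analytic_bounded m (p + m) 0 v"
    unfolding v_def[abs_def] using \<epsilon> Q C d by (auto simp: H_inf_def intro!: analytic_bounded_intros)
  have w: "analytic_bounded m (p + m) 0 w"
    unfolding w_def[abs_def] using \<epsilon> v F d by (auto intro!: analytic_bounded_intros)
  have x: "analytic_bounded n (p + m) 0 x"
    unfolding x_def[abs_def] using \<Gamma>(2) w B by (auto simp: H_inf_def intro!: analytic_bounded_intros)
  have y: "analytic_bounded p (p + m) 0 y"
    unfolding y_def[abs_def] using x C d by (auto intro!: analytic_bounded_intros)
  have u: "analytic_bounded m (p + m) 0 u"
    unfolding u_def[abs_def] using x w F by (auto intro!: analytic_bounded_intros)
  have Ak: "A + B * F + L * C \<in> carrier_mat n n" using A B C F L by auto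
  have mC: "- C \<in> carrier_mat p n" using C by simp
  have Qp: "Q \<in> L_prop m p" using Q H_inf_subset_L_prop by blast
  have "\<forall>\<^sub>F s in right_half_planes. four_block_mat (1\<^sub>m p) (- (C * inv_mat (s \<cdot>\<^sub>m 1\<^sub>m n - A) * B)) (- K s) (1\<^sub>m m)
      * (y s @\<^sub>r u s) = 1\<^sub>m (p + m)"
    using K eventually_Re_gt[of 0] eventually_resolvent[OF A] eventually_resolvent[OF Ak]
      eventually_loop_invertible[OF Ak B mC Qp] L_prop_eventually_carrier[OF Qp]
  proof eventually_elim
    case (elim s)
    note loop = closed_loop_from_parameter[OF A B C F L elim(6) d elim(3) \<Lambda>(1)[OF elim(2)] \<Gamma>(1)[OF elim(2)]
        elim(4,5,1)]
    have R: "inv_mat (s \<cdot>\<^sub>m 1\<^sub>m n - A) \<in> carrier_mat n n"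
      using A elim(3) by (intro inv_mat_inverse(1)) (auto intro: minus_carrier_mat)
    have G: "C * inv_mat (s \<cdot>\<^sub>m 1\<^sub>m n - A) * B \<in> carrier_mat p m" using R B C by auto
    have Kc: "K s \<in> carrier_mat m p"
      using state_space_lft_carrier[of "- L" n p F m] L F elim(1) by auto
    have "four_block_mat (1\<^sub>m p) (- (C * inv_mat (s \<cdot>\<^sub>m 1\<^sub>m n - A) * B)) (- K s) (1\<^sub>m m) * (y s @\<^sub>r u s) =
      (y s - C * inv_mat (s \<cdot>\<^sub>m 1\<^sub>m n - A) * B * u s) @\<^sub>r (u s - K s * y s)"
      using y u elim(2) by (intro loop_mult_append_rows[OF G Kc]) (auto dest: analytic_bounded_carrier)
    also have "\<dots> = d1 @\<^sub>r d2"
      using loop unfolding y_def u_def x_def w_def v_def \<epsilon>_def by simp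
    finally show ?case using dd by simp
  qed
  moreover have "(\<lambda>s. y s @\<^sub>r u s) \<in> H_inf (p + m) (p + m)"
    unfolding H_inf_def using analytic_bounded_append_rows[OF y u] by simp
  ultimately show ?thesis by (intro bexI[where x = "\<lambda>s. y s @\<^sub>r u s"])
qed

text \<open>The stable closed-loop map \<open>H\<close> yields the signals \<open>y\<close> and \<open>u\<close> for the disturbances of
  \<open>parameter_from_closed_loop\<close>. The formula for \<open>Q\<close> defines it on the whole open right half plane,
  whereas \<open>K\<close> matters only far to the right.\<close>
lemma parameter_if_stabilizing:
  assumes A: "A \<in> carrier_mat n n" and B: "B \<in> carrier_mat n m" and C: "C \<in> carrier_mat p n"
    and F: "F \<in> carrier_mat m n" and L: "L \<in> carrier_mat n p"
    and \<Gamma>: "\<And>s. Re s > 0 \<Longrightarrow> det (s \<cdot>\<^sub>m 1\<^sub>m n - (A + B * F)) \<noteq> 0"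
      "(\<lambda>s. inv_mat (s \<cdot>\<^sub>m 1\<^sub>m n - (A + B * F))) \<in> H_inf n n"
    and \<Lambda>: "\<And>s. Re s > 0 \<Longrightarrow> det (s \<cdot>\<^sub>m 1\<^sub>m n - (A + L * C)) \<noteq> 0"
      "(\<lambda>s. inv_mat (s \<cdot>\<^sub>m 1\<^sub>m n - (A + L * C))) \<in> H_inf n n"
    and K: "K \<in> L_prop m p" and H: "H \<in> H_inf (p + m) (p + m)"
    and KH: "\<forall>\<^sub>F s in right_half_planes.
      four_block_mat (1\<^sub>m p) (- (C * inv_mat (s \<cdot>\<^sub>m 1\<^sub>m n - A) * B)) (- K s) (1\<^sub>m m) * H s = 1\<^sub>m (p + m)"
  shows "\<exists>Q \<in> H_inf m p. \<forall>\<^sub>F s in right_half_planes.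
    Q s = state_space_lft A (- L) B (- F) C s (K s) \<and> K s = state_space_lft (A + B * F + L * C) (- L) B F (- C) s (Q s)"
proof -
  define \<zeta> where "\<zeta> s = - (inv_mat (s \<cdot>\<^sub>m 1\<^sub>m n - (A + B * F)) * L)" for s
  define d1 where "d1 s = 1\<^sub>m p + C * \<zeta> s" for s
  define d2 where "d2 s = - (F * \<zeta> s)" for s
  define Z where "Z s = H s * (d1 s @\<^sub>r d2 s)" for s
  define y where "y s = row_slice 0 p (Z s)" for s
  define u where "u s = row_slice p m (Z s)" for s
  define Q where "Q s = u s - F * (inv_mat (s \<cdot>\<^sub>m 1\<^sub>m n - (A + L * C)) * (B * u s - L * y s + L * d1 s))" for s
  have \<zeta>: "analytic_bounded n p 0 \<zeta>"
    unfolding \<zeta>_def[abs_def] using \<Gamma>(2) L by (auto simp: H_inf_def intro!: analytic_bounded_intros)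
  have d1: "analytic_bounded p p 0 d1" and d2: "analytic_bounded m p 0 d2"
    unfolding d1_def[abs_def] d2_def[abs_def] using \<zeta> C F by (auto intro!: analytic_bounded_intros)
  have Z: "analytic_bounded (p + m) p 0 Z"
    unfolding Z_def[abs_def] using H analytic_bounded_append_rows[OF d1 d2]
    by (auto simp: H_inf_def intro!: analytic_bounded_intros)
  have y: "analytic_bounded p p 0 y" and u: "analytic_bounded m p 0 u"
    unfolding y_def[abs_def] u_def[abs_def] by (auto intro!: analytic_bounded_row_slice[OF Z])
  have Q: "Q \<in> H_inf m p"
    unfolding Q_def[abs_def] using \<Lambda>(2) B F L d1 y u by (auto simp: H_inf_def intro!: analytic_bounded_intros)
  have Qp: "Q \<in> L_prop m p" using Q H_inf_subset_L_prop by blast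
  have Ak: "A + B * F + L * C \<in> carrier_mat n n" using A B C F L by auto
  have mC: "- C \<in> carrier_mat p n" using C by simp
  have "\<forall>\<^sub>F s in right_half_planes. Q s = state_space_lft A (- L) B (- F) C s (K s) \<and>
    K s = state_space_lft (A + B * F + L * C) (- L) B F (- C) s (Q s)"
    using KH eventually_Re_gt[of 0] eventually_resolvent[OF A] eventually_resolvent[OF Ak]
      eventually_loop_invertible[OF A B C K] eventually_loop_invertible[OF Ak B mC Qp]
      L_prop_eventually_carrier[OF K]
  proof eventually_elim
    case (elim s)
    let ?G = "C * inv_mat (s \<cdot>\<^sub>m 1\<^sub>m n - A) * B"
    let ?M = "four_block_mat (1\<^sub>m p) (- ?G) (- K s) (1\<^sub>m m)"
    have R: "inv_mat (s \<cdot>\<^sub>m 1\<^sub>m n - A) \<in> carrier_mat n n"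
      using A elim(3) by (intro inv_mat_inverse(1)) (auto intro: minus_carrier_mat)
    have G: "?G \<in> carrier_mat p m" using R B C by auto
    have M: "?M \<in> carrier_mat (p + m) (p + m)" by auto
    have c: "y s \<in> carrier_mat p p" "u s \<in> carrier_mat m p" "d1 s \<in> carrier_mat p p" "d2 s \<in> carrier_mat m p"
      "Z s \<in> carrier_mat (p + m) p" "H s \<in> carrier_mat (p + m) (p + m)"
      using analytic_bounded_carrier[OF y elim(2)] analytic_bounded_carrier[OF u elim(2)]
        analytic_bounded_carrier[OF d1 elim(2)] analytic_bounded_carrier[OF d2 elim(2)]
        analytic_bounded_carrier[OF Z elim(2)] analytic_bounded_carrier[OF _ elim(2)] H by (auto simp: H_inf_def)
    have dd: "d1 s @\<^sub>r d2 s \<in> carrier_mat (p + m) p" using c by auto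
    have "(y s - ?G * u s) @\<^sub>r (u s - K s * y s) = ?M * (y s @\<^sub>r u s)"
      using c by (intro loop_mult_append_rows[OF G elim(7), symmetric])
    also have "y s @\<^sub>r u s = Z s" unfolding y_def u_def using c by (intro row_slice_append_rows)
    also have "?M * Z s = ?M * H s * (d1 s @\<^sub>r d2 s)"
      unfolding Z_def by (rule assoc_mult_mat[OF M c(6) dd, symmetric])
    also have "\<dots> = d1 s @\<^sub>r d2 s" unfolding elim(1) using dd by simp
    finally have eq: "(y s - ?G * u s) @\<^sub>r (u s - K s * y s) = d1 s @\<^sub>r d2 s" .
    have "y s - ?G * u s \<in> carrier_mat p p" "u s - K s * y s \<in> carrier_mat m p"
      using mult_carrier_mat[OF G c(2)] mult_carrier_mat[OF elim(7) c(1)] by (auto intro: minus_carrier_mat)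
    from append_rows_inject[OF this(1) c(3) this(2) c(4) eq]
    have yu: "y s - ?G * u s = d1 s" "u s - K s * y s = d2 s" by auto
    have Qs: "Q s = state_space_lft A (- L) B (- F) C s (K s)"
      unfolding Q_def using parameter_from_closed_loop[OF A B C F L elim(7) c(1,2) elim(3) \<Lambda>(1)[OF elim(2)]
          \<Gamma>(1)[OF elim(2)] elim(5)] yu unfolding d1_def d2_def \<zeta>_def by simp
    then show ?case
      using controller_of_parameter[OF A B C F L elim(7,3) \<Lambda>(1)[OF elim(2)] elim(4,5) Qs elim(6)] by blast
  qed
  then show ?thesis using Q by blast
qed

lemma eventually_lft_youla_J:
  assumes A: "A \<in> carrier_mat n n" and B: "B \<in> carrier_mat n m" and C: "C \<in> carrier_mat p n"
    and F: "F \<in> carrier_mat m n" and L: "L \<in> carrier_mat n p" and Q: "Q \<in> L_prop m p"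
  shows "\<forall>\<^sub>F s in right_half_planes. lft (youla_J A B C F L s) (Q s) =
    state_space_lft (cmat A + cmat B * cmat F + cmat L * cmat C) (- cmat L) (cmat B) (cmat F) (- cmat C) s (Q s)"
proof -
  have Ak: "A + B * F + L * C \<in> carrier_mat n n" and mL: "- L \<in> carrier_mat n p" and mC: "- C \<in> carrier_mat p n"
    using A B C F L by auto
  have cAk: "cmat (A + B * F + L * C) = cmat A + cmat B * cmat F + cmat L * cmat C"
    using A B C F L by (simp add: cmat_add[of _ n n] of_real_hom.mat_hom_mult[of _ n m] of_real_hom.mat_hom_mult[of _ n p])
  show ?thesis
    using eventually_resolvent[of "cmat (A + B * F + L * C)" n, simplified, OF Ak] L_prop_eventually_carrier[OF Q]
  proof eventually_elim
    case (elim s)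
    show ?case
      using lft_realization[OF Ak mL B F mC elim(2,1)] B C F L
      by (simp add: youla_J_def cAk cmat_uminus)
  qed
qed

theorem lemma3:
  fixes N :: nat
    and nx nw nu ny :: "nat \<Rightarrow> nat"
    and nz :: nat
    and A B1 B2 C1 C2 D12 D21 Fd Ld :: "real mat"
    and E :: "(nat \<times> nat) set"
    and \<tau> :: real
    and K :: "complex \<Rightarrow> complex mat"
  assumes "block_diagonal N nx nx A"
    and "block_diagonal N nx nw B1"
    and "block_diagonal N nx nu B2"
    and "block_diagonal N ny nx C2"
    and "block_diagonal N ny nw D21"
    and "C1 \<in> carrier_mat nz (tot N nx)"
    and "D12 \<in> carrier_mat nz (tot N nu)"
    and "E \<subseteq> {..<N} \<times> {..<N}"
    and "\<tau> \<ge> 0"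
    and "riccati_assms A B2 C1 D12"
    and "\<And>i. i < N \<Longrightarrow> riccati_assms
           (transpose_mat (blk nx nx A i i)) (transpose_mat (blk ny nx C2 i i))
           (transpose_mat (blk nx nw B1 i i)) (transpose_mat (blk ny nw D21 i i))"
    and "block_diagonal N nu nx Fd"
    and "block_diagonal N nx ny Ld"
    and "hurwitz (A + B2 * Fd)"
    and "hurwitz (A + Ld * C2)"
  shows "K \<in> S_delay N nu ny E \<tau> \<and>
           stabilizes (tot N nu) (tot N ny) K (plant A B1 B2 C1 C2 D12 D21)
         \<longleftrightarrow>
         (\<exists>Q \<in> H_inf (tot N nu) (tot N ny) \<inter> S_delay N nu ny E \<tau>.
            K \<approx>\<^sub>t\<^sub>f (\<lambda>s. lft (youla_J A B2 C2 Fd Ld s) (Q s)))"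
proof -
  let ?n = "tot N nx" and ?m = "tot N nu" and ?p = "tot N ny"
  let ?a = "cmat A" and ?b = "cmat B2" and ?c = "cmat C2" and ?f = "cmat Fd" and ?l = "cmat Ld"
  note \<tau> = assms(9)
  have A: "A \<in> carrier_mat ?n ?n" and B: "B2 \<in> carrier_mat ?n ?m" and C: "C2 \<in> carrier_mat ?p ?n"
    and F: "Fd \<in> carrier_mat ?m ?n" and L: "Ld \<in> carrier_mat ?n ?p"
    and B1: "B1 \<in> carrier_mat ?n (tot N nw)" and D21: "D21 \<in> carrier_mat ?p (tot N nw)"
    using assms by (auto simp: block_diagonal_def)
  have c: "?a \<in> carrier_mat ?n ?n" "?b \<in> carrier_mat ?n ?m" "?c \<in> carrier_mat ?p ?n"
    "?f \<in> carrier_mat ?m ?n" "?l \<in> carrier_mat ?n ?p"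
    using A B C F L by auto
  note pat = assms(1,3,4,12,13)[THEN block_diagonal_pattern]
  have AF: "A + B2 * Fd \<in> carrier_mat ?n ?n" "cmat (A + B2 * Fd) = ?a + ?b * ?f"
    and AL: "A + Ld * C2 \<in> carrier_mat ?n ?n" "cmat (A + Ld * C2) = ?a + ?l * ?c"
    using A B C F L by (auto simp: cmat_add[of _ ?n ?n] of_real_hom.mat_hom_mult[of _ ?n ?m] of_real_hom.mat_hom_mult[of _ ?n ?p])
  have Ak: "A + B2 * Fd + Ld * C2 \<in> carrier_mat ?n ?n" using AF L C by auto
  have cAk: "cmat (A + B2 * Fd + Ld * C2) = ?a + ?b * ?f + ?l * ?c"
    using AF L C by (simp add: cmat_add[of _ ?n ?n] of_real_hom.mat_hom_mult[of _ ?n ?p])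
  have pAk: "pattern (=) nx nx (A + B2 * Fd + Ld * C2)"
    using A B C F L pat
    by (intro pattern_add pattern_mult[where q = nu] pattern_mult[where q = ny]) auto
  have \<Gamma>: "det (s \<cdot>\<^sub>m 1\<^sub>m ?n - (?a + ?b * ?f)) \<noteq> 0"
    and \<Lambda>: "det (s \<cdot>\<^sub>m 1\<^sub>m ?n - (?a + ?l * ?c)) \<noteq> 0" if "Re s > 0" for s
    using hurwitz_det_nonzero[OF AF(1) assms(14)] hurwitz_det_nonzero[OF AL(1) assms(15)] that
    by (auto simp: AF(2) AL(2))
  note H_inf = hurwitz_resolvent_H_inf[OF AF(1) assms(14), unfolded AF(2)]
    hurwitz_resolvent_H_inf[OF AL(1) assms(15), unfolded AL(2)]
  show ?thesis
  proof (intro iffI conjI)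
    assume K: "K \<in> S_delay N nu ny E \<tau> \<and>
      stabilizes ?m ?p K (plant A B1 B2 C1 C2 D12 D21)"
    have Kp: "K \<in> L_prop ?m ?p" using S_delay_imp_L_prop[OF \<tau>] K by blast
    obtain H where H: "H \<in> H_inf (?p + ?m) (?p + ?m)"
      "\<forall>\<^sub>F s in right_half_planes. four_block_mat (1\<^sub>m ?p) (- (?c * inv_mat (s \<cdot>\<^sub>m 1\<^sub>m ?n - ?a) * ?b)) (- K s)
        (1\<^sub>m ?m) * H s = 1\<^sub>m (?p + ?m)"
      using conjunct2[OF K] unfolding stabilizes_plant_iff[OF A B1 B assms(6) C assms(7) D21 Kp] by (elim bexE)
    obtain Q where Q: "Q \<in> H_inf ?m ?p" and "\<forall>\<^sub>F s in right_half_planes.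
      Q s = state_space_lft ?a (- ?l) ?b (- ?f) ?c s (K s) \<and> K s = state_space_lft (?a + ?b * ?f + ?l * ?c) (- ?l) ?b ?f (- ?c) s (Q s)"
      using parameter_if_stabilizing[OF c \<Gamma> H_inf(1) \<Lambda> H_inf(2) Kp H] by blast
    then have evQ: "\<forall>\<^sub>F s in right_half_planes. Q s = state_space_lft ?a (- ?l) ?b (- ?f) ?c s (K s)"
      and evK: "\<forall>\<^sub>F s in right_half_planes.
        K s = state_space_lft (?a + ?b * ?f + ?l * ?c) (- ?l) ?b ?f (- ?c) s (Q s)"
      by (auto elim: eventually_mono)
    have "(\<lambda>s. state_space_lft ?a (cmat (- Ld)) ?b (cmat (- Fd)) ?c s (K s)) \<in> S_delay N nu ny E \<tau>"
      using A B C F L pat K by (intro S_delay_state_space_lft[OF \<tau>]) (auto intro: pattern_uminus)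
    then have "Q \<in> S_delay N nu ny E \<tau>"
      by (rule S_delay_cong) (use evQ in eventually_elim, simp add: cmat_uminus)
    moreover have "K \<approx>\<^sub>t\<^sub>f (\<lambda>s. lft (youla_J A B2 C2 Fd Ld s) (Q s))"
      unfolding tf_eq_def
      using evK eventually_lft_youla_J[OF A B C F L subsetD[OF H_inf_subset_L_prop Q]]
      by eventually_elim simp
    ultimately show "\<exists>Q \<in> H_inf ?m ?p \<inter> S_delay N nu ny E \<tau>.
        K \<approx>\<^sub>t\<^sub>f (\<lambda>s. lft (youla_J A B2 C2 Fd Ld s) (Q s))"
      using Q by blast
  next
    assume "\<exists>Q \<in> H_inf ?m ?p \<inter> S_delay N nu ny E \<tau>.
        K \<approx>\<^sub>t\<^sub>f (\<lambda>s. lft (youla_J A B2 C2 Fd Ld s) (Q s))"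
    then obtain Q where Q: "Q \<in> H_inf ?m ?p" "Q \<in> S_delay N nu ny E \<tau>"
      and KQ: "\<forall>\<^sub>F s in right_half_planes. K s = lft (youla_J A B2 C2 Fd Ld s) (Q s)"
      by (auto simp: tf_eq_def)
    have ev: "\<forall>\<^sub>F s in right_half_planes.
        K s = state_space_lft (?a + ?b * ?f + ?l * ?c) (- ?l) ?b ?f (- ?c) s (Q s)"
      using KQ eventually_lft_youla_J[OF A B C F L subsetD[OF H_inf_subset_L_prop Q(1)]]
      by eventually_elim simp
    have "(\<lambda>s. state_space_lft (cmat (A + B2 * Fd + Ld * C2)) (cmat (- Ld)) ?b ?f (cmat (- C2)) s (Q s))
        \<in> S_delay N nu ny E \<tau>"
      using Ak pAk B C F L pat Q by (intro S_delay_state_space_lft[OF \<tau>]) (auto intro: pattern_uminus)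
    then show KS: "K \<in> S_delay N nu ny E \<tau>"
      by (rule S_delay_cong) (use ev in eventually_elim, simp add: cmat_uminus cAk)
    have Kp: "K \<in> L_prop ?m ?p" using S_delay_imp_L_prop[OF \<tau> KS] .
    show "stabilizes ?m ?p K (plant A B1 B2 C1 C2 D12 D21)"
      unfolding stabilizes_plant_iff[OF A B1 B assms(6) C assms(7) D21 Kp]
      using stabilizing_if_parameter[OF c \<Gamma> H_inf(1) \<Lambda> H_inf(2) Q(1) ev] .
  qed
qed

end
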